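(* Let $X_1,\dots,X_n\subset\mathbb{R}^d$ be compact, $X=X_1\times\dots\times X_n$, and let $\mu_i\in\mathcal{P}(X_i)$ satisfy $\mu_1\preceq_c\dots\preceq_c\mu_n$. Let $c,p\in C(X)$, set $c_\varepsilon=c+\varepsilon p$, and let $$\Pi^M_\varepsilon(\mu_1,\dots,\mu_n)=\operatorname*{arg\,min}_{\pi\in\Pi_M(\mu_1,\dots,\mu_n)}\int c_\varepsilon\,d\pi .$$ Let $\varepsilon_k\to0$ with $\varepsilon_k>0$, and for each $k$ let $\pi_k\in\Pi^M_{\varepsilon_k}(\mu_1,\dots,\mu_n)$. Then any weak limit $\pi_0$ of $(\pi_k)$ (along a subsequence if necessary) belongs to $\Pi^M_0(\mu_1,\dots,\mu_n)$ and attains the infimum $$\inf_{\pi\in\Pi^M_0(\mu_1,\dots,\mu_n)}\int p\,d\pi .$$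
   Context: $\mathcal{P}(X)$ is the set of Borel probability measures on $X$. Convex order: $\mu\preceq_c\nu$ means $\int\varphi\,d\mu\le\int\varphi\,d\nu$ for all convex $\varphi:\mathbb{R}^d\to\mathbb{R}$. $\Pi(\mu_1,\dots,\mu_n)$ is the set of probability measures on $X_1\times\dots\times X_n$ with $i$-th marginal $\mu_i$; $\mathrm{Proj}_I(\pi)$ is the marginal of $\pi$ on the coordinates indexed by $I$. Martingale couplings: $\Pi_M(\mu_1,\dots,\mu_n)$ is the set of $\pi\in\Pi(\mu_1,\dots,\mu_n)$ such that for each $i=1,\dots,n-1$, disintegrating $\pi=\mathrm{Proj}_{1\dots i}(\pi)\otimes\kappa_{1\dots i}^{i+1,\dots,n}$ (with $\kappa_{1\dots i}^{i+1,\dots,n}$ the conditional probability of $x_{i+1},\dots,x_n$ given $x_1,\dots,x_i$), one has $\int x_{i+1}\,\kappa_{1\dots i}^{i+1,\dots,n}(x_1,\dots,x_i,dx_{i+1},\dots,dx_n)=x_i$ for $\mathrm{Proj}_{1\dots i}(\pi)$-almost every $(x_1,\dots,x_i)$. *)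

theory Defs
  imports "HOL-Probability.Probability"
begin

text \<open>
  A point of \<open>X\<^sub>1 \<times> \<dots> \<times> X\<^sub>n\<close> is an element of \<open>PiE {1..n} X\<close>, i.e. a function
  \<open>nat \<Rightarrow> 'a\<close> that is \<open>undefined\<close> outside \<open>{1..n}\<close>. Since the coordinates outside
  the index set are constant, the subspace topology inherited from the product topology on
  \<open>nat \<Rightarrow> 'a\<close> is the topology of the finite product, so that \<open>C(X)\<close> is expressed by
  \<open>continuous_on (PiE {1..n} X)\<close>.
\<close>

definition prod_borel :: "(nat \<Rightarrow> 'a::euclidean_space set) \<Rightarrow> nat set \<Rightarrow> (nat \<Rightarrow> 'a) measure"
  where "prod_borel X I = PiM I (\<lambda>i. restrict_space borel (X i))"

lemma space_prod_borel [simp]: "space (prod_borel X I) = PiE I X"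
  by (simp add: prod_borel_def space_PiM space_restrict_space)

text \<open>The product \<open>\<sigma>\<close>-algebra is the Borel \<open>\<sigma>\<close>-algebra of that topology.\<close>

lemma sets_prod_borel:
  fixes X :: "nat \<Rightarrow> 'a::euclidean_space set"
  shows "sets (prod_borel X I) = sets (restrict_space borel (PiE I X))"
proof
  have coord: "(\<lambda>x. x i) \<in> measurable (restrict_space borel (PiE I X)) borel" for i
    by (intro measurable_restrict_space1 borel_measurable_continuous_onI
        continuous_on_product_coordinates)
  have "(\<lambda>x. x) \<in> measurable (restrict_space borel (PiE I X)) (prod_borel X I)"
    unfolding prod_borel_def
  proof (rule measurable_PiM_single')
    show "(\<lambda>x. x i) \<in> measurable (restrict_space borel (PiE I X)) (restrict_space borel (X i))"
      if "i \<in> I" for i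
      using that coord by (intro measurable_restrict_space2) (auto simp: space_restrict_space)
  qed (auto simp: space_restrict_space)
  then show "sets (prod_borel X I) \<subseteq> sets (restrict_space borel (PiE I X))"
  proof (intro subsetI)
    fix A assume m: "(\<lambda>x. x) \<in> measurable (restrict_space borel (PiE I X)) (prod_borel X I)"
      and A: "A \<in> sets (prod_borel X I)"
    from sets.sets_into_space[OF A] have "(\<lambda>x. x) -` A \<inter> space (restrict_space borel (PiE I X)) = A"
      by (auto simp: space_restrict_space)
    with measurable_sets[OF m A] show "A \<in> sets (restrict_space borel (PiE I X))" by simp
  qed
next
  have coord: "(\<lambda>x. x i) \<in> borel_measurable (prod_borel X I)" for i
  proof (cases "i \<in> I")
    case True
    then have "(\<lambda>x. x i) \<in> measurable (prod_borel X I) (restrict_space borel (X i))"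
      unfolding prod_borel_def by (rule measurable_component_singleton)
    then show ?thesis by (simp add: measurable_restrict_space2_iff)
  next
    case False
    have "(\<lambda>x. x i) \<in> borel_measurable (prod_borel X I)
        \<longleftrightarrow> (\<lambda>x. undefined :: 'a) \<in> borel_measurable (prod_borel X I)"
      using False by (intro measurable_cong) (auto simp: PiE_def extensional_def)
    then show ?thesis by simp
  qed
  have "(\<lambda>x. x) \<in> measurable (prod_borel X I) (PiM UNIV (\<lambda>_. borel))"
    using coord by (intro measurable_PiM_single') auto
  then have m: "(\<lambda>x. x) \<in> borel_measurable (prod_borel X I)"
    by (simp cong: measurable_cong_sets add: sets_PiM_equal_borel)
  show "sets (restrict_space borel (PiE I X)) \<subseteq> sets (prod_borel X I)"
  proof
    fix A assume "A \<in> sets (restrict_space borel (PiE I X))"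
    then obtain B where B: "B \<in> sets borel" "A = PiE I X \<inter> B"
      by (auto simp: sets_restrict_space)
    with measurable_sets[OF m B(1)] show "A \<in> sets (prod_borel X I)" by (simp add: Int_commute)
  qed
qed

text \<open>
  Only meant for measures for which convex functions are integrable, such as the compactly
  supported ones: the Bochner integral of a non-integrable function is 0.
\<close>

definition convex_order :: "'a::euclidean_space measure \<Rightarrow> 'a measure \<Rightarrow> bool"
  where "convex_order \<mu> \<nu> \<longleftrightarrow>
    (\<forall>\<phi>. convex_on UNIV \<phi> \<longrightarrow> (\<integral>x. \<phi> x \<partial>\<mu>) \<le> (\<integral>x. \<phi> x \<partial>\<nu>))"

definition couplings ::
  "nat \<Rightarrow> (nat \<Rightarrow> 'a::euclidean_space set) \<Rightarrow> (nat \<Rightarrow> 'a measure) \<Rightarrow> (nat \<Rightarrow> 'a) measure set"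
  where "couplings n X \<mu> =
    {\<pi> \<in> space (prob_algebra (prod_borel X {1..n})).
       \<forall>i\<in>{1..n}. distr \<pi> (restrict_space borel (X i)) (\<lambda>x. x i) = \<mu> i}"

definition Proj ::
  "(nat \<Rightarrow> 'a::euclidean_space set) \<Rightarrow> nat set \<Rightarrow> (nat \<Rightarrow> 'a) measure \<Rightarrow> (nat \<Rightarrow> 'a) measure"
  where "Proj X I \<pi> = distr \<pi> (prod_borel X I) (\<lambda>x. restrict x I)"

text \<open>
  \<open>\<pi> = Proj\<^sub>I(\<pi>) \<otimes> \<kappa>\<close> for a probability kernel \<open>\<kappa>\<close> from the coordinates in
  \<open>I\<close> to the coordinates in \<open>J\<close>.
\<close>

definition disintegration ::
  "(nat \<Rightarrow> 'a::euclidean_space set) \<Rightarrow> nat set \<Rightarrow> nat set \<Rightarrow> (nat \<Rightarrow> 'a) measure \<Rightarrow>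
    ((nat \<Rightarrow> 'a) \<Rightarrow> (nat \<Rightarrow> 'a) measure) \<Rightarrow> bool"
  where "disintegration X I J \<pi> \<kappa> \<longleftrightarrow>
    \<kappa> \<in> measurable (prod_borel X I) (prob_algebra (prod_borel X J)) \<and>
    \<pi> = Proj X I \<pi> \<bind> (\<lambda>x. distr (\<kappa> x) (prod_borel X (I \<union> J)) (\<lambda>y. merge I J (x, y)))"

text \<open>
  Disintegrations exist and are almost everywhere unique here, so quantifying \<open>\<kappa>\<close>
  existentially or universally gives the same set.
\<close>

definition martingale_couplings ::
  "nat \<Rightarrow> (nat \<Rightarrow> 'a::euclidean_space set) \<Rightarrow> (nat \<Rightarrow> 'a measure) \<Rightarrow> (nat \<Rightarrow> 'a) measure set"
  where "martingale_couplings n X \<mu> =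
    {\<pi> \<in> couplings n X \<mu>. \<forall>i\<in>{1..<n}. \<exists>\<kappa>.
       disintegration X {1..i} {i+1..n} \<pi> \<kappa> \<and>
       (AE x in Proj X {1..i} \<pi>. (\<integral>y. y (i+1) \<partial>(\<kappa> x)) = x i)}"

definition optimal_martingale_couplings ::
  "nat \<Rightarrow> (nat \<Rightarrow> 'a::euclidean_space set) \<Rightarrow> (nat \<Rightarrow> 'a measure) \<Rightarrow>
    ((nat \<Rightarrow> 'a) \<Rightarrow> real) \<Rightarrow> ((nat \<Rightarrow> 'a) \<Rightarrow> real) \<Rightarrow> real \<Rightarrow> (nat \<Rightarrow> 'a) measure set"
  where "optimal_martingale_couplings n X \<mu> c p \<epsilon> =
    {\<pi>. is_arg_min (\<lambda>\<pi>. \<integral>x. c x + \<epsilon> * p x \<partial>\<pi>) (\<lambda>\<pi>. \<pi> \<in> martingale_couplings n X \<mu>) \<pi>}"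

text \<open>Weak convergence of Borel probability measures on the subspace \<open>S\<close>.\<close>

definition weak_conv_on ::
  "'b::topological_space set \<Rightarrow> (nat \<Rightarrow> 'b measure) \<Rightarrow> 'b measure \<Rightarrow> bool"
  where "weak_conv_on S \<pi> \<pi>\<^sub>0 \<longleftrightarrow>
    (\<forall>f :: 'b \<Rightarrow> real. continuous_on S f \<and> bounded (f ` S) \<longrightarrow>
       (\<lambda>k. \<integral>x. f x \<partial>(\<pi> k)) \<longlonglongrightarrow> (\<integral>x. f x \<partial>\<pi>\<^sub>0))"

end

theory Submission
  imports Defs
begin

text \<open>
  A coupling \<open>\<pi>\<close> is a martingale coupling iff
  \<open>\<integral> f(x\<^sub>1, \<dots>, x\<^sub>i) (x\<^bsub>i+1\<^esub> - x\<^sub>i) \<bullet> b d\<pi> = 0\<close> for all \<open>i\<close>, all basis vectors \<open>b\<close>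
  and all bounded continuous \<open>f\<close>. On compact sets this condition is stable under weak limits, so
  \<open>\<pi>\<^sub>0\<close> is a martingale coupling. Passing to the limit in
  \<open>\<integral> c + \<epsilon>\<^sub>k p d\<pi>\<^sub>k \<le> \<integral> c + \<epsilon>\<^sub>k p d\<rho>\<close> shows that \<open>\<pi>\<^sub>0\<close> minimises \<open>\<integral> c\<close>. If
  \<open>\<rho>\<close> also minimises \<open>\<integral> c\<close>, then \<open>\<integral> c d\<rho> \<le> \<integral> c d\<pi>\<^sub>k\<close>, hence \<open>\<integral> p d\<pi>\<^sub>k \<le> \<integral> p d\<rho>\<close>, and
  the limit gives \<open>\<integral> p d\<pi>\<^sub>0 \<le> \<integral> p d\<rho>\<close>.

  The martingale condition refers to a disintegration of \<open>\<pi>\<^sub>0\<close>. For a second factor in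
  \<open>[0, 1]\<close> its kernel is built from conditional distribution functions, obtained by the
  Radon-Nikodym theorem; the general case reduces to this one because a product of Borel subsets of
  a Euclidean space is a measurable retract of \<open>[0, 1]\<close>.
\<close>

subsection \<open>Disintegration\<close>

text \<open>On the set where \<open>g < f\<close> the difference \<open>f - g\<close> is positive,
  yet its integral there is at most 0 by hypothesis. A nonnegative function with zero integral
  vanishes almost everywhere.\<close>

lemma AE_le_if_set_integral_le:
  fixes f g :: "'b \<Rightarrow> real"
  assumes [measurable]: "integrable M f" "integrable M g"
    and le: "\<And>A. A \<in> sets M \<Longrightarrow> (\<integral>x. indicator A x * f x \<partial>M) \<le> (\<integral>x. indicator A x * g x \<partial>M)"
  shows "AE x in M. f x \<le> g x"
proof -
  define A where "A = {x \<in> space M. g x < f x}"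
  have A[measurable]: "A \<in> sets M" unfolding A_def by measurable
  have i: "integrable M (\<lambda>x. indicator A x * f x)" "integrable M (\<lambda>x. indicator A x * g x)"
    by (auto intro!: integrable_real_mult_indicator simp: mult.commute[of "indicator A _"] assms)
  let ?h = "\<lambda>x. indicator A x * f x - indicator A x * g x"
  have "integral\<^sup>L M ?h \<le> 0"
    using le[OF A] by (simp add: i)
  moreover have nn: "AE x in M. 0 \<le> ?h x"
    by (auto simp: A_def indicator_def)
  ultimately have "integral\<^sup>L M ?h = 0"
    using integral_nonneg_AE[OF nn] by linarith
  then have "AE x in M. ?h x = 0"
    using integral_nonneg_eq_0_iff_AE[OF Bochner_Integration.integrable_diff[OF i] nn] by blast
  then show ?thesis
    using AE_space by eventually_elim (auto simp: A_def indicator_def split: if_splits)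
qed

text \<open>Domination gives absolute continuity, so the Radon-Nikodym theorem applies. It also
  keeps the mass of \<open>N\<close> finite, so the extended derivative can be replaced by a real
  function and used in Bochner integrals.\<close>

lemma dominated_measure_density:
  assumes "finite_measure M" and sets: "sets N = sets M"
    and le: "\<And>A. A \<in> sets M \<Longrightarrow> emeasure N A \<le> emeasure M A"
  obtains f :: "'b \<Rightarrow> real" where "integrable M f"
    "\<And>A. A \<in> sets M \<Longrightarrow> (\<integral>x. indicator A x * f x \<partial>M) = measure N A"
proof -
  interpret finite_measure M by fact
  note [measurable_cong] = sets
  have "absolutely_continuous M N"
    using le sets by (auto simp: absolutely_continuous_def null_sets_def) (metis le_zero_eq)
  then have d: "density M (RN_deriv M N) = N"
    using sets by (rule density_RN_deriv)
  define f where "f x = enn2real (RN_deriv M N x)" for x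
  \<comment> \<open>A density with finite integral is finite almost everywhere, so
    \<open>enn2real\<close> changes it only on a null set.\<close>
  have "emeasure N (space M) \<le> emeasure M (space M)" by (intro le) auto
  then have "(\<integral>\<^sup>+x. RN_deriv M N x \<partial>M) \<noteq> \<infinity>"
    by (subst (asm) d[symmetric])
       (auto simp: emeasure_density top_unique cong: nn_integral_cong)
  then have "AE x in M. RN_deriv M N x \<noteq> \<infinity>"
    by (intro nn_integral_PInf_AE) auto
  then have fin: "AE x in M. ennreal (f x) = RN_deriv M N x"
    by eventually_elim (simp add: f_def less_top)
  have [measurable]: "f \<in> borel_measurable M" unfolding f_def by measurable
  have fn: "0 \<le> f x" for x by (simp add: f_def)
  have eq: "(\<integral>\<^sup>+x. ennreal (indicator A x * f x) \<partial>M) = emeasure N A" if [measurable]: "A \<in> sets M" for A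
  proof -
    have "emeasure N A = (\<integral>\<^sup>+x. RN_deriv M N x * indicator A x \<partial>M)"
      by (subst d[symmetric]) (simp add: emeasure_density)
    also have "\<dots> = (\<integral>\<^sup>+x. ennreal (indicator A x * f x) \<partial>M)"
      using fin by (intro nn_integral_cong_AE) (auto elim!: eventually_mono simp: indicator_def)
    finally show ?thesis by simp
  qed
  show ?thesis
  proof (rule that)
    have "emeasure N (space M) < \<infinity>"
      using le[OF sets.top] emeasure_finite[of "space M"] by (auto simp: less_top[symmetric] top_unique)
    with eq[OF sets.top] have "(\<integral>\<^sup>+x. ennreal (f x) \<partial>M) < \<infinity>"
      by (simp cong: nn_integral_cong)
    then show "integrable M f"
      using fn by (intro integrableI_nonneg) auto
    show "(\<integral>x. indicator A x * f x \<partial>M) = measure N A" if A[measurable]: "A \<in> sets M" for A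
      using eq[OF A] fn by (subst integral_eq_nn_integral) (auto simp: measure_def)
  qed
qed

section \<open>Kernels from conditional distribution functions\<close>

text \<open>For fixed \<open>q\<close>, the measure sending \<open>A\<close> to the mass of
  \<open>A \<times> {..q}\<close> is dominated by the first marginal \<open>\<nu>\<close>. Its
  density \<open>f q\<close> is the conditional distribution function at \<open>q\<close>. Relations
  between different \<open>q\<close> hold only almost everywhere, so a version \<open>G\<close> that
  is regular at every point is built first, and the kernel consists of the measures with
  distribution functions \<open>G y\<close>.\<close>

lemma disintegration_unit_interval:
  fixes \<pi> :: "('b \<times> real) measure"
  assumes \<pi>: "\<pi> \<in> space (prob_algebra (N \<Otimes>\<^sub>M borel))"
    and unit: "AE z in \<pi>. snd z \<in> {0..1}"
  obtains \<kappa> where "\<kappa> \<in> N \<rightarrow>\<^sub>M prob_algebra borel"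
    "\<pi> = distr \<pi> N fst \<bind> (\<lambda>y. distr (\<kappa> y) (N \<Otimes>\<^sub>M borel) (Pair y))"
proof -
  from \<pi> have sets_\<pi>[measurable_cong]: "sets \<pi> = sets (N \<Otimes>\<^sub>M borel)" and "prob_space \<pi>"
    by (auto simp: space_prob_algebra)
  interpret \<pi>: prob_space \<pi> by fact
  have space_\<pi>: "space \<pi> = space N \<times> UNIV"
    using sets_eq_imp_space_eq[OF sets_\<pi>] by (simp add: space_pair_measure)
  define \<nu> where "\<nu> = distr \<pi> N fst"
  have sets_\<nu>[measurable_cong]: "sets \<nu> = sets N" by (simp add: \<nu>_def)
  have space_\<nu>: "space \<nu> = space N" by (simp add: \<nu>_def)
  interpret \<nu>: prob_space \<nu>
    unfolding \<nu>_def by (rule \<pi>.prob_space_distr) measurable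
  define m where "m A q = measure \<pi> (A \<times> {..q})" for A and q :: real
  have rect[measurable]: "A \<times> {..q} \<in> sets \<pi>" if "A \<in> sets N" for A and q :: real
    using that by measurable
  have "\<exists>f. integrable \<nu> f \<and> (\<forall>A\<in>sets N. (\<integral>y. indicator A y * f y \<partial>\<nu>) = m A q)" for q
  proof -
    \<comment> \<open>Cutting \<pi> at second coordinate \<open>q\<close> and projecting to the
      first factor gives the measure with values \<open>m A q\<close>.\<close>
    define M' where "M' = distr (restrict_space \<pi> (space N \<times> {..q})) N fst"
    have [measurable]: "fst \<in> restrict_space \<pi> (space N \<times> {..q}) \<rightarrow>\<^sub>M N"
      by (intro measurable_restrict_space1) measurable
    have em: "emeasure M' A = emeasure \<pi> (A \<times> {..q})" if "A \<in> sets N" for A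
    proof -
      have "fst -` A \<inter> space (restrict_space \<pi> (space N \<times> {..q})) = A \<times> {..q}"
        using sets.sets_into_space[OF that] by (auto simp: space_restrict_space space_\<pi>)
      then show ?thesis
        using that sets.sets_into_space[OF that]
        by (simp add: M'_def emeasure_distr) (subst emeasure_restrict_space, auto simp: space_\<pi>)
    qed
    have le: "emeasure M' A \<le> emeasure \<nu> A" if "A \<in> sets \<nu>" for A
    proof -
      from that have A: "A \<in> sets N" by (simp add: \<nu>_def)
      have "emeasure \<pi> (A \<times> {..q}) \<le> emeasure \<pi> (fst -` A \<inter> space \<pi>)"
        using A sets.sets_into_space[OF A] by (intro emeasure_mono) (auto simp: space_\<pi>)
      with A show ?thesis by (simp add: em \<nu>_def emeasure_distr)
    qed
    obtain f where "integrable \<nu> f"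
      "\<And>A. A \<in> sets \<nu> \<Longrightarrow> (\<integral>x. indicator A x * f x \<partial>\<nu>) = measure M' A"
      by (rule dominated_measure_density[OF \<nu>.finite_measure_axioms _ le])
         (auto simp: M'_def sets_\<nu>)
    then show ?thesis
      by (intro exI[of _ f]) (auto simp: sets_\<nu> m_def measure_def em)
  qed
  then obtain f where f: "\<And>q. integrable \<nu> (f q)"
    and fm: "\<And>q A. A \<in> sets N \<Longrightarrow> (\<integral>y. indicator A y * f q y \<partial>\<nu>) = m A q"
    by metis
  have [measurable]: "f q \<in> borel_measurable \<nu>" for q
    using f by (rule borel_measurable_integrable)

  \<comment> \<open>All mass lies over [0, 1], so \<open>f q\<close> is almost everywhere 0 for
    negative \<open>q\<close> and 1 for \<open>q\<close> at least 1. Imposing these values and the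
    range [0, 1] at every point gives \<open>G y\<close> the right limits at both ends for all
    \<open>y\<close>.\<close>
  define F where "F q y = (if q < 0 then 0 else if 1 \<le> q then 1 else max 0 (min 1 (f q y)))" for q y
  have F01: "0 \<le> F q y" "F q y \<le> 1" for q y by (auto simp: F_def)
  have F_meas[measurable]: "F q \<in> borel_measurable N" for q
  proof -
    have "f q \<in> borel_measurable N" using f[of q] by (simp add: measurable_cong_sets[OF sets_\<nu>])
    then show ?thesis unfolding F_def by measurable
  qed
  have F_int: "integrable \<nu> (F q)" for q
    using F01 by (intro \<nu>.integrable_const_bound[where B=1]) auto
  have m_nonneg: "0 \<le> m A q" for A q by (simp add: m_def)
  have m_le: "m A q \<le> (\<integral>y. indicator A y * 1 \<partial>\<nu>)" if A[measurable]: "A \<in> sets N" for A q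
  proof -
    have "m A q \<le> measure \<pi> (fst -` A \<inter> space \<pi>)"
      unfolding m_def using sets.sets_into_space[OF A]
      by (intro \<pi>.finite_measure_mono) (auto simp: space_\<pi>)
    also have "\<dots> = measure \<nu> A"
      by (simp add: \<nu>_def measure_distr)
    finally show ?thesis using A by (simp add: sets_\<nu>)
  qed
  have m_mono: "m A q \<le> m A q'" if "A \<in> sets N" "q \<le> q'" for A q q'
    unfolding m_def using that by (intro \<pi>.finite_measure_mono) auto
  have f_mono: "AE y in \<nu>. f q y \<le> f q' y" if "q \<le> q'" for q q'
    using that by (intro AE_le_if_set_integral_le f) (auto simp: fm m_mono sets_\<nu>)
  have f_ge0: "AE y in \<nu>. 0 \<le> f q y" for q
    by (intro AE_le_if_set_integral_le f) (auto simp: fm m_nonneg sets_\<nu>)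
  have f_le1: "AE y in \<nu>. f q y \<le> 1" for q
    using m_le by (intro AE_le_if_set_integral_le f) (auto simp: fm sets_\<nu>)
  have f_neg: "AE y in \<nu>. f q y \<le> 0" if "q < 0" for q
  proof (intro AE_le_if_set_integral_le f)
    fix A assume "A \<in> sets \<nu>"
    then have A: "A \<in> sets N" by (simp add: sets_\<nu>)
    have "m A q = 0"
    proof -
      have "AE z in \<pi>. z \<notin> A \<times> {..q}"
        using unit by eventually_elim (use that in auto)
      then have "A \<times> {..q} \<in> null_sets \<pi>"
        using A by (subst AE_iff_null_sets) auto
      then show ?thesis unfolding m_def by (rule measure_eq_0_null_sets)
    qed
    with A show "(\<integral>y. indicator A y * f q y \<partial>\<nu>) \<le> (\<integral>y. indicator A y * 0 \<partial>\<nu>)" by (simp add: fm)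
  qed auto
  have f_ge: "AE y in \<nu>. 1 \<le> f q y" if "1 \<le> q" for q
  proof (intro AE_le_if_set_integral_le f)
    fix A assume "A \<in> sets \<nu>"
    then have A[measurable]: "A \<in> sets N" by (simp add: sets_\<nu>)
    have "m A q = measure \<pi> (fst -` A \<inter> space \<pi>)"
      unfolding m_def
    proof (rule measure_eq_AE)
      show "AE x in \<pi>. (x \<in> A \<times> {..q}) = (x \<in> fst -` A \<inter> space \<pi>)"
        using unit AE_space by eventually_elim (use that in auto)
    qed (use A in measurable)
    also have "\<dots> = measure \<nu> A"
      by (simp add: \<nu>_def measure_distr)
    finally show "(\<integral>y. indicator A y * 1 \<partial>\<nu>) \<le> (\<integral>y. indicator A y * f q y \<partial>\<nu>)"
      using A by (simp add: fm sets_\<nu>)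
  qed auto
  have F_eq: "AE y in \<nu>. F q y = f q y" for q
    using f_ge0[of q] f_le1[of q] f_neg[of q] f_ge[of q]
    by (cases "q < 0"; cases "1 \<le> q") (auto simp: F_def elim!: eventually_elim2)
  have Fm: "(\<integral>y. indicator A y * F q y \<partial>\<nu>) = m A q" if [measurable]: "A \<in> sets N" for A q
    using that F_eq[of q]
    by (subst fm[symmetric]) (auto intro!: integral_cong_AE elim!: eventually_mono)

  \<comment> \<open>The infimum over rational \<open>q > t\<close> makes \<open>G y\<close> a distribution function for every \<open>y\<close>, so no
    exceptional null set has to be removed.\<close>
  define G where "G y t = (INF q\<in>{q\<in>\<rat>. t < q}. F q y)" for y t
  have ne: "{q\<in>\<rat>. t < q} \<noteq> {}" for t :: real
    using Rats_no_top_le Rats_dense_in_real[of t "t + 1"] by auto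
  have bdd: "bdd_below ((\<lambda>q. F q y) ` {q\<in>\<rat>. t < q})" for y t
    by (rule bdd_belowI[of _ 0]) (auto simp: F01)
  have G01: "0 \<le> G y t" "G y t \<le> 1" for y t
  proof -
    show "0 \<le> G y t" unfolding G_def by (intro cINF_greatest ne F01)
    obtain q where "q \<in> {q\<in>\<rat>. t < q}" using ne by blast
    then have "G y t \<le> F q y" unfolding G_def by (intro cINF_lower bdd)
    with F01(2)[of q y] show "G y t \<le> 1" by linarith
  qed
  have G_mono: "G y s \<le> G y t" if "s \<le> t" for y s t
    unfolding G_def using that by (intro cINF_superset_mono bdd ne) auto
  have G_right: "continuous (at_right t) (G y)" for y t
    unfolding continuous_within
  proof (rule order_tendstoI)
    fix a assume "a < G y t"
    then show "eventually (\<lambda>x. a < G y x) (at_right t)"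
      using less_le_trans[OF _ G_mono] by (intro eventually_at_rightI[of t "t + 1"]) auto
  next
    fix a assume "G y t < a"
    \<comment> \<open>The rational \<open>q\<close> that brings the infimum at \<open>t\<close>
      below \<open>a\<close> is also admissible in the infimum at every
      \<open>x < q\<close>.\<close>
    then obtain q where q: "q \<in> \<rat>" "t < q" "F q y < a"
      unfolding G_def cINF_less_iff[OF ne bdd] by blast
    then have "G y x < a" if "x < q" for x
      using that unfolding G_def cINF_less_iff[OF ne bdd] by blast
    with q show "eventually (\<lambda>x. G y x < a) (at_right t)"
      by (intro eventually_at_rightI[of t q]) auto
  qed
  have G_bot: "(G y \<longlongrightarrow> 0) at_bot" for y
  proof (rule tendsto_eventually)
    have "G y t = 0" if "t < - 1" for t
    proof -
      have "G y t \<le> F (- 1) y" unfolding G_def using that by (intro cINF_lower bdd) auto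
      with G01(1)[of y t] show ?thesis by (simp add: F_def)
    qed
    then show "eventually (\<lambda>t. G y t = 0) at_bot"
      using eventually_at_bot_dense by blast
  qed
  have G_top: "(G y \<longlongrightarrow> 1) at_top" for y
  proof (rule tendsto_eventually)
    have "G y t = 1" if "1 < t" for t
    proof -
      have "1 \<le> G y t" unfolding G_def using that by (intro cINF_greatest ne) (auto simp: F_def)
      with G01(2)[of y t] show ?thesis by simp
    qed
    then show "eventually (\<lambda>t. G y t = 1) at_top"
      using eventually_at_top_dense by blast
  qed
  have G_meas[measurable]: "(\<lambda>y. G y t) \<in> borel_measurable N" for t
    unfolding G_def
    by (intro borel_measurable_cINF bdd countable_subset[OF _ countable_rat]) (auto simp: F_meas)
  have G_int: "integrable \<nu> (\<lambda>y. G y t)" for t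
    using G01 by (intro \<nu>.integrable_const_bound[where B=1]) auto
  have Gm: "(\<integral>y. indicator A y * G y t \<partial>\<nu>) = m A t" if A[measurable]: "A \<in> sets N" for A t
  proof (rule antisym)
    have ind: "integrable \<nu> (\<lambda>y. indicator A y * g y)" if "integrable \<nu> g" for g :: "'b \<Rightarrow> real"
      using that A by (simp add: mult.commute[of "indicator A _"] integrable_real_mult_indicator sets_\<nu>)
    \<comment> \<open>Lower bound: there are countably many rational \<open>q\<close>, so all
      comparisons of \<open>f t\<close> with \<open>F q\<close> hold off one common null set and the
      infimum can be taken pointwise.\<close>
    have "AE y in \<nu>. \<forall>q\<in>{q\<in>\<rat>. t < q}. f t y \<le> F q y"
    proof (subst AE_ball_countable)
      show "countable {q \<in> \<rat>. t < q}" by (rule countable_subset[OF _ countable_rat]) auto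
      show "\<forall>q\<in>{q\<in>\<rat>. t < q}. AE y in \<nu>. f t y \<le> F q y"
      proof
        fix q assume "q \<in> {q\<in>\<rat>. t < q}"
        with f_mono[of t q] F_eq[of q] show "AE y in \<nu>. f t y \<le> F q y" by auto
      qed
    qed
    then have "AE y in \<nu>. f t y \<le> G y t"
      by eventually_elim (auto simp: G_def intro!: cINF_greatest ne)
    then have "(\<integral>y. indicator A y * f t y \<partial>\<nu>) \<le> (\<integral>y. indicator A y * G y t \<partial>\<nu>)"
      by (intro integral_mono_AE ind f G_int) (auto elim!: eventually_mono intro: mult_left_mono)
    then show "m A t \<le> (\<integral>y. indicator A y * G y t \<partial>\<nu>)" by (simp add: fm)
    \<comment> \<open>Upper bound: a rational \<open>q\<close> between \<open>t\<close> and
      \<open>t + 1 / Suc k\<close> bounds \<open>G y t\<close> by \<open>F q y\<close>. Continuity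
      of \<pi> from above then lets \<open>k\<close> tend to infinity.\<close>
    have "(\<integral>y. indicator A y * G y t \<partial>\<nu>) \<le> m A (t + 1 / Suc k)" for k
    proof -
      obtain q where q: "q \<in> \<rat>" "t < q" "q < t + 1 / Suc k"
        using Rats_dense_in_real[of t "t + 1 / Suc k"] by auto
      have "(\<integral>y. indicator A y * G y t \<partial>\<nu>) \<le> (\<integral>y. indicator A y * F q y \<partial>\<nu>)"
        using q by (intro integral_mono ind F_int G_int mult_left_mono)
          (auto simp: G_def intro!: cINF_lower bdd)
      also have "\<dots> \<le> m A (t + 1 / Suc k)"
        using q by (simp add: Fm m_mono)
      finally show ?thesis .
    qed
    moreover have "(\<lambda>k. m A (t + 1 / Suc k)) \<longlonglongrightarrow> measure \<pi> (\<Inter>k. A \<times> {..t + 1 / Suc k})"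
      unfolding m_def
    proof (rule \<pi>.finite_Lim_measure_decseq)
      show "decseq (\<lambda>k. A \<times> {..t + 1 / Suc k})"
        by (auto simp: decseq_def field_simps intro: order_trans)
    qed auto
    moreover have "(\<Inter>k. A \<times> {..t + 1 / Suc k}) = A \<times> {..t}"
    proof -
      have "x \<le> t" if "\<And>k. x \<le> t + 1 / real (Suc k)" for x
      proof (rule LIMSEQ_le_const)
        show "(\<lambda>k. t + 1 / real (Suc k)) \<longlonglongrightarrow> t"
          using tendsto_add[OF tendsto_const[of t] LIMSEQ_inverse_real_of_nat]
          by (simp add: inverse_eq_divide)
      qed (use that in auto)
      then show ?thesis by (auto intro: order_trans)
    qed
    ultimately show "(\<integral>y. indicator A y * G y t \<partial>\<nu>) \<le> m A t"
      by (intro LIMSEQ_le_const[of _ "m A t"]) (auto simp: m_def)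
  qed

  define \<kappa> where "\<kappa> y = interval_measure (G y)" for y
  have \<kappa>_prob: "prob_space (\<kappa> y)" for y
    unfolding \<kappa>_def
    using real_distribution_interval_measure[of "G y"] G_mono G_right G_bot G_top
    by (simp add: real_distribution_def)
  have \<kappa>_atMost: "emeasure (\<kappa> y) {..t} = ennreal (G y t)" for y t
    unfolding \<kappa>_def
    using emeasure_interval_measure_Iic[of "G y"] G_mono G_right G_bot by blast
  \<comment> \<open>The half-lines form an intersection-stable generator, and their masses under the
    kernel are the measurable functions \<open>G y t\<close> of \<open>y\<close>.\<close>
  have \<kappa>[measurable]: "\<kappa> \<in> N \<rightarrow>\<^sub>M prob_algebra borel"
  proof (rule measurable_prob_algebra_generated)
    show "sets (borel :: real measure) = sigma_sets UNIV (range atMost)"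
      by (subst borel_eq_atMost) (simp add: image_image)
    show "Int_stable (range (atMost :: real \<Rightarrow> _))"
      by (auto simp: Int_stable_def)
    fix A :: "real set" assume "A \<in> range atMost"
    then show "(\<lambda>y. emeasure (\<kappa> y) A) \<in> borel_measurable N"
      by (auto simp: \<kappa>_atMost)
  qed (auto simp: \<kappa>_prob, auto simp: \<kappa>_def)
  have \<nu>_space: "\<nu> \<in> space (prob_algebra N)"
    using sets_\<nu> \<nu>.prob_space_axioms by (simp add: space_prob_algebra)
  have K[measurable]: "(\<lambda>y. distr (\<kappa> y) (N \<Otimes>\<^sub>M borel) (Pair y)) \<in> N \<rightarrow>\<^sub>M prob_algebra (N \<Otimes>\<^sub>M borel)"
    by measurable
  \<comment> \<open>Both measures give \<open>A \<times> {..t}\<close> the mass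
    \<open>m A t\<close>. These rectangles are stable under intersection and generate the product
    sigma-algebra.\<close>
  have "\<pi> = \<nu> \<bind> (\<lambda>y. distr (\<kappa> y) (N \<Otimes>\<^sub>M borel) (Pair y))"
  proof (rule measure_eqI_generator_eq)
    let ?E = "{A \<times> B | A B. A \<in> sets N \<and> B \<in> range (atMost :: real \<Rightarrow> _)}"
    have gen: "sets (N \<Otimes>\<^sub>M borel) = sigma_sets (space N \<times> UNIV) ?E"
    proof -
      have "sets (N \<Otimes>\<^sub>M (borel :: real measure))
          = sets (sigma (space N \<times> UNIV) ?E)"
      proof -
        have "sets (sigma (space N) (sets N) \<Otimes>\<^sub>M sigma UNIV (range (atMost :: real \<Rightarrow> _)))
            = sets (sigma (space N \<times> UNIV) ?E)"
        proof (rule arg_cong[where f=sets], rule sigma_prod)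
          show "\<exists>E\<subseteq>sets N. countable E \<and> space N = \<Union>E"
            by (intro exI[of _ "{space N}"]) auto
          show "\<exists>E\<subseteq>range (atMost :: real \<Rightarrow> _). countable E \<and> UNIV = \<Union>E"
            by (intro exI[of _ "range (\<lambda>k::nat. {..real k})"]) (auto simp: real_arch_simple)
        qed (auto dest: sets.sets_into_space)
        also have "sets (sigma (space N) (sets N) \<Otimes>\<^sub>M sigma UNIV (range (atMost :: real \<Rightarrow> _)))
            = sets (N \<Otimes>\<^sub>M borel)"
          by (intro sets_pair_measure_cong) (simp_all add: borel_eq_atMost sets.sigma_sets_eq)
        finally show ?thesis by simp
      qed
      then show ?thesis
        using sets.sets_into_space by (subst (asm) sets_measure_of) fastforce+
    qed
    show "Int_stable ?E"
    proof (rule Int_stableI)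
      fix a b assume "a \<in> ?E" "b \<in> ?E"
      then obtain A s B t where ab: "a = A \<times> {..s}" "b = B \<times> {..t}" "A \<in> sets N" "B \<in> sets N"
        by auto
      have "a \<inter> b = (A \<inter> B) \<times> {..min s t}" by (auto simp: ab)
      with ab show "a \<inter> b \<in> ?E" by blast
    qed
    show "sets \<pi> = sigma_sets (space N \<times> UNIV) ?E"
      unfolding sets_\<pi> by (rule gen)
    show "sets (\<nu> \<bind> (\<lambda>y. distr (\<kappa> y) (N \<Otimes>\<^sub>M borel) (Pair y))) = sigma_sets (space N \<times> UNIV) ?E"
      using gen sets_bind'[OF \<nu>_space K] by simp
    show "range (\<lambda>k::nat. space N \<times> {..real k}) \<subseteq> ?E" by auto
    show "(\<Union>k::nat. space N \<times> {..real k}) = space N \<times> UNIV"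
      by (auto simp: real_arch_simple)
    show "emeasure \<pi> (space N \<times> {..real k}) \<noteq> \<infinity>" for k by simp
    fix X assume "X \<in> ?E"
    then obtain A t where X: "X = A \<times> {..t}" and A[measurable]: "A \<in> sets N" by auto
    have "emeasure (\<nu> \<bind> (\<lambda>y. distr (\<kappa> y) (N \<Otimes>\<^sub>M borel) (Pair y))) X
        = (\<integral>\<^sup>+y. emeasure (distr (\<kappa> y) (N \<Otimes>\<^sub>M borel) (Pair y)) X \<partial>\<nu>)"
      by (rule emeasure_bind_prob_algebra[OF \<nu>_space K]) (auto simp: X)
    also have "\<dots> = (\<integral>\<^sup>+y. ennreal (indicator A y * G y t) \<partial>\<nu>)"
    proof (rule nn_integral_cong)
      fix y assume "y \<in> space \<nu>"
      then have y[measurable]: "y \<in> space N" by (simp add: space_\<nu>)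
      have s: "sets (\<kappa> y) = sets borel" by (simp add: \<kappa>_def)
      have "Pair y -` X \<inter> space (\<kappa> y) = (if y \<in> A then {..t} else {})"
        by (auto simp: X \<kappa>_def)
      then show "emeasure (distr (\<kappa> y) (N \<Otimes>\<^sub>M borel) (Pair y)) X = ennreal (indicator A y * G y t)"
        using y s by (subst emeasure_distr)
          (auto simp: X \<kappa>_atMost measurable_cong_sets[OF s refl])
    qed
    also have "\<dots> = ennreal (\<integral>y. indicator A y * G y t \<partial>\<nu>)"
      using A G_int[of t] G01(1)
      by (intro nn_integral_eq_integral)
         (auto simp: mult.commute[of "indicator A _"] integrable_real_mult_indicator sets_\<nu>)
    also have "\<dots> = emeasure \<pi> X"
      using A by (simp add: Gm m_def X \<pi>.emeasure_eq_measure)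
    finally show "emeasure \<pi> X = emeasure (\<nu> \<bind> (\<lambda>y. distr (\<kappa> y) (N \<Otimes>\<^sub>M borel) (Pair y))) X" by simp
  qed (use sets.sets_into_space in fastforce)
  with \<kappa> show thesis
    unfolding \<nu>_def by (rule that)
qed

section \<open>Coding a point of a product by one real number\<close>

text \<open>Ternary expansions with digits 0 and 1 are unique, unlike binary ones.\<close>

definition ternary_code :: "(nat \<Rightarrow> bool) \<Rightarrow> real" where
  "ternary_code b = (\<Sum>k. of_bool (b k) * (1/3) ^ Suc k)"

text \<open>Deletes the leading digit of a code. The digits after the first contribute at most 1/6,
  so the first digit is 1 exactly when the code is at least 1/3.\<close>

definition ternary_shift :: "real \<Rightarrow> real" where
  "ternary_shift x = (if 1/3 \<le> x then 3 * x - 1 else 3 * x)"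

lemma summable_ternary_code: "summable (\<lambda>k. of_bool (b k) * (1/3 :: real) ^ Suc k)"
  by (rule summable_comparison_test'[where N=0 and g="\<lambda>k. (1/3) ^ k"])
     (auto simp: summable_geometric)

lemma ternary_code_nonneg: "0 \<le> ternary_code b"
  unfolding ternary_code_def by (intro suminf_nonneg summable_ternary_code) auto

lemma ternary_code_le: "ternary_code b \<le> 1/2"
proof -
  have s: "(\<lambda>k. (1/3) * (1/3 :: real) ^ k) sums ((1/3) * (1 / (1 - 1/3)))"
    by (intro sums_mult geometric_sums) auto
  have "ternary_code b \<le> (\<Sum>k. (1/3) * (1/3 :: real) ^ k)"
    unfolding ternary_code_def
    by (intro suminf_le summable_ternary_code sums_summable[OF s]) auto
  with s show ?thesis by (simp add: sums_iff)
qed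

lemma ternary_code_unfold:
  "ternary_code b = (of_bool (b 0) + ternary_code (\<lambda>k. b (Suc k))) / 3"
proof -
  have "ternary_code (\<lambda>k. b (Suc k)) / 3 = (\<Sum>k. of_bool (b (Suc k)) * (1/3) ^ Suc (Suc k))"
    unfolding ternary_code_def
    by (subst suminf_divide[OF summable_ternary_code, symmetric]) (simp add: field_simps)
  with suminf_split_head[OF summable_ternary_code[of b]] show ?thesis
    by (simp add: ternary_code_def field_simps)
qed

text \<open>Each shift drops one digit, and the threshold 1/3 then reads the next one. Digits are
  thus recovered by Borel functions, which makes decoding measurable.\<close>

lemma ternary_digit: "1/3 \<le> (ternary_shift ^^ k) (ternary_code b) \<longleftrightarrow> b k"
proof (induction k arbitrary: b)
  case 0
  show ?case
    using ternary_code_unfold[of b] ternary_code_nonneg[of "\<lambda>k. b (Suc k)"]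
      ternary_code_le[of "\<lambda>k. b (Suc k)"]
    by (cases "b 0") auto
next
  case (Suc k)
  have "ternary_shift (ternary_code b) = ternary_code (\<lambda>k. b (Suc k))"
    using ternary_code_unfold[of b] ternary_code_nonneg[of "\<lambda>k. b (Suc k)"]
      ternary_code_le[of "\<lambda>k. b (Suc k)"]
    by (cases "b 0") (auto simp: ternary_shift_def)
  with Suc[of "\<lambda>k. b (Suc k)"] show ?case
    by (simp del: funpow.simps add: funpow_Suc_right)
qed

lemma measurable_ternary_shift: "(ternary_shift ^^ k) \<in> borel_measurable borel"
proof (induction k)
  case (Suc k)
  have "ternary_shift \<in> borel_measurable borel"
    unfolding ternary_shift_def by measurable
  with Suc show ?case by (auto intro: measurable_comp)
qed (simp add: id_def)

text \<open>Having a measurable left inverse \<open>h\<close> of \<open>g\<close> avoids showing that the image of \<open>g\<close> is Borel.\<close>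

lemma disintegration_retract_of_unit_interval:
  assumes \<pi>: "\<pi> \<in> space (prob_algebra (N \<Otimes>\<^sub>M S))"
    and g[measurable]: "g \<in> S \<rightarrow>\<^sub>M borel" and h[measurable]: "h \<in> borel \<rightarrow>\<^sub>M S"
    and gh: "\<And>z. z \<in> space S \<Longrightarrow> h (g z) = z" and g01: "\<And>z. z \<in> space S \<Longrightarrow> g z \<in> {0..1::real}"
  obtains \<kappa> where "\<kappa> \<in> N \<rightarrow>\<^sub>M prob_algebra S"
    "\<pi> = distr \<pi> N fst \<bind> (\<lambda>y. distr (\<kappa> y) (N \<Otimes>\<^sub>M S) (Pair y))"
proof -
  from \<pi> have sets_\<pi>[measurable_cong]: "sets \<pi> = sets (N \<Otimes>\<^sub>M S)" and "prob_space \<pi>"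
    by (auto simp: space_prob_algebra)
  interpret \<pi>: prob_space \<pi> by fact
  have space_\<pi>: "space \<pi> = space N \<times> space S"
    using sets_eq_imp_space_eq[OF sets_\<pi>] by (simp add: space_pair_measure)
  define \<rho> where "\<rho> = distr \<pi> (N \<Otimes>\<^sub>M borel) (map_prod id g)"
  have [measurable]: "map_prod id g \<in> N \<Otimes>\<^sub>M S \<rightarrow>\<^sub>M N \<Otimes>\<^sub>M borel"
    "map_prod id h \<in> N \<Otimes>\<^sub>M borel \<rightarrow>\<^sub>M N \<Otimes>\<^sub>M S"
    by (simp_all add: map_prod_def id_def case_prod_unfold)
  have "\<rho> \<in> space (prob_algebra (N \<Otimes>\<^sub>M borel))"
    by (simp add: \<rho>_def space_prob_algebra) (intro \<pi>.prob_space_distr, measurable)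
  moreover have "AE z in \<rho>. snd z \<in> {0..1}"
    unfolding \<rho>_def using g01
    by (subst AE_distr_iff) (auto simp: space_\<pi>)
  ultimately obtain \<kappa> where \<kappa>[measurable]: "\<kappa> \<in> N \<rightarrow>\<^sub>M prob_algebra borel"
    and \<rho>: "\<rho> = distr \<rho> N fst \<bind> (\<lambda>y. distr (\<kappa> y) (N \<Otimes>\<^sub>M borel) (Pair y))"
    by (rule disintegration_unit_interval)
  have fst_\<rho>: "distr \<rho> N fst = distr \<pi> N fst"
    unfolding \<rho>_def by (subst distr_distr) (auto simp: comp_def)
  have ne: "space (distr \<pi> N fst) \<noteq> {}"
    using \<pi>.not_empty by (auto simp: space_\<pi>)
  show thesis
  proof (rule that)
    show "(\<lambda>y. distr (\<kappa> y) S h) \<in> N \<rightarrow>\<^sub>M prob_algebra S" by measurable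
    \<comment> \<open>Since \<open>h\<close> inverts \<open>g\<close> on the space of
      \<open>S\<close>, pushing \<open>\<rho>\<close> forward by \<open>h\<close> gives back
      \<pi>.\<close>
    have "\<pi> = distr \<rho> (N \<Otimes>\<^sub>M S) (map_prod id h)"
    proof -
      have "distr \<rho> (N \<Otimes>\<^sub>M S) (map_prod id h) = distr \<pi> (N \<Otimes>\<^sub>M S) (\<lambda>z. z)"
        unfolding \<rho>_def by (subst distr_distr) (auto intro!: distr_cong simp: space_\<pi> gh)
      also have "\<dots> = \<pi>" by (rule distr_id2) (simp add: sets_\<pi>)
      finally show ?thesis by simp
    qed
    also have "\<dots> = distr \<pi> N fst \<bind> (\<lambda>y. distr (distr (\<kappa> y) (N \<Otimes>\<^sub>M borel) (Pair y)) (N \<Otimes>\<^sub>M S) (map_prod id h))"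
    proof -
      have "(\<lambda>y. distr (\<kappa> y) (N \<Otimes>\<^sub>M borel) (Pair y)) \<in> distr \<pi> N fst \<rightarrow>\<^sub>M subprob_algebra (N \<Otimes>\<^sub>M borel)"
        by (intro measurable_prob_algebraD) measurable
      from distr_bind[OF this ne, of "map_prod id h" "N \<Otimes>\<^sub>M S"] show ?thesis
        by (subst \<rho>) (simp add: fst_\<rho>)
    qed
    \<comment> \<open>Attaching \<open>y\<close> and then applying \<open>h\<close> to the second
      component agrees with applying \<open>h\<close> first and attaching \<open>y\<close>
      afterwards.\<close>
    also have "\<dots> = distr \<pi> N fst \<bind> (\<lambda>y. distr (distr (\<kappa> y) S h) (N \<Otimes>\<^sub>M S) (Pair y))"
    proof (rule bind_cong[OF refl])
      fix y assume "y \<in> space (distr \<pi> N fst)"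
      then have y: "y \<in> space N" by simp
      have [measurable_cong]: "sets (\<kappa> y) = sets borel"
        using measurable_space[OF \<kappa> y] by (simp add: space_prob_algebra)
      show "distr (distr (\<kappa> y) (N \<Otimes>\<^sub>M borel) (Pair y)) (N \<Otimes>\<^sub>M S) (map_prod id h)
          = distr (distr (\<kappa> y) S h) (N \<Otimes>\<^sub>M S) (Pair y)"
        using y by (subst (1 2) distr_distr) (auto simp: comp_def)
    qed
    finally show "\<pi> = \<dots>" .
  qed
qed

text \<open>Supplies the maps needed by \<open>disintegration_retract_of_unit_interval\<close> for a
  product of Borel sets: \<open>g\<close> encodes a point and \<open>h\<close> decodes it.\<close>

lemma prod_borel_retract_of_unit_interval:
  fixes X :: "nat \<Rightarrow> 'a::euclidean_space set"
  assumes "countable I" and X: "\<And>i. i \<in> I \<Longrightarrow> X i \<in> sets borel" "\<And>i. i \<in> I \<Longrightarrow> X i \<noteq> {}"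
  obtains g :: "(nat \<Rightarrow> 'a) \<Rightarrow> real" and h where
    "g \<in> prod_borel X I \<rightarrow>\<^sub>M borel" "h \<in> borel \<rightarrow>\<^sub>M prod_borel X I"
    "\<And>z. z \<in> PiE I X \<Longrightarrow> h (g z) = z" "\<And>z. z \<in> PiE I X \<Longrightarrow> g z \<in> {0..1}"
proof (cases "I = {}")
  case True
  then show ?thesis
    by (intro that[of "\<lambda>_. 0" "\<lambda>_ _. undefined"]) (auto simp: prod_borel_def PiM_empty)
next
  case False
  \<comment> \<open>A point is determined by the truth values of \<open>z i \<bullet> b < q\<close> for rational \<open>q\<close>, and \<open>g\<close> packs
    these countably many bits into one real number.\<close>
  define D where "D = I \<times> (Basis :: 'a set) \<times> (\<rat> :: real set)"
  have D: "countable D" "D \<noteq> {}"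
    using False \<open>countable I\<close> by (auto simp: D_def countable_rat countable_finite intro!: countable_SIGMA)
  define below :: "(nat \<Rightarrow> 'a) \<Rightarrow> nat \<Rightarrow> bool"
    where "below z k = (case from_nat_into D k of (i, b, q) \<Rightarrow> z i \<bullet> b < q)" for z k
  define g where "g z = ternary_code (below z)" for z
  define digit where "digit d t \<longleftrightarrow> 1/3 \<le> (ternary_shift ^^ to_nat_on D d) t" for d and t :: real
  have digit_g: "digit (i, b, q) (g z) \<longleftrightarrow> z i \<bullet> b < q" if "(i, b, q) \<in> D" for i b q z
    unfolding digit_def g_def ternary_digit below_def using that D by simp
  \<comment> \<open>A real number is the infimum of the rationals above it. The infimum is taken in
    the extended reals because \<open>t\<close> may code no point, in which case the set of selected
    rationals can be empty or unbounded below.\<close>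
  define coord where "coord t i b = real_of_ereal (INF q\<in>\<rat>. if digit (i, b, q) t then ereal q else \<infinity>)"
    for t i and b :: 'a
  have coord_g: "coord (g z) i b = z i \<bullet> b" if ib: "i \<in> I" "b \<in> Basis" for z i b
  proof -
    have "(INF q\<in>\<rat>. if digit (i, b, q) (g z) then ereal q else \<infinity>) = ereal (z i \<bullet> b)"
    proof (rule INF_eqI)
      fix q :: real assume "q \<in> \<rat>"
      then have "(i, b, q) \<in> D" using ib by (simp add: D_def)
      then show "ereal (z i \<bullet> b) \<le> (if digit (i, b, q) (g z) then ereal q else \<infinity>)"
        by (simp add: digit_g)
    next
      fix y assume y: "\<And>q. q \<in> \<rat> \<Longrightarrow> y \<le> (if digit (i, b, q) (g z) then ereal q else \<infinity>)"
      have y': "y \<le> ereal q" if "q \<in> \<rat>" "z i \<bullet> b < q" for q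
        using y[OF that(1)] that ib by (simp add: digit_g D_def)
      show "y \<le> ereal (z i \<bullet> b)"
      proof (rule ccontr)
        assume "\<not> y \<le> ereal (z i \<bullet> b)"
        then obtain r where "z i \<bullet> b < r" "ereal r < y"
          by (metis ereal_dense2 less_ereal.simps(1) not_le)
        moreover from Rats_dense_in_real[OF this(1)] obtain q where "q \<in> \<rat>" "z i \<bullet> b < q" "q < r"
          by blast
        ultimately show False using y'[of q] by (metis ereal_less_eq(3) not_le order.strict_trans order_le_less_trans)
      qed
    qed
    then show ?thesis by (simp add: coord_def)
  qed
  have [measurable]: "Measurable.pred borel (digit d)" for d
  proof -
    note measurable_ternary_shift[measurable]
    show ?thesis unfolding digit_def by measurable
  qed
  have [measurable]: "(\<lambda>t. coord t i b) \<in> borel_measurable borel" for i b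
    unfolding coord_def by (intro borel_measurable_real_of_ereal borel_measurable_INF countable_rat) measurable
  define vec where "vec t i = (\<Sum>b\<in>Basis. coord t i b *\<^sub>R b)" for t i
  have vec_meas[measurable]: "(\<lambda>t. vec t i) \<in> borel_measurable borel" for i
    unfolding vec_def by measurable
  have vec_g: "vec (g z) i = z i" if "i \<in> I" for z i
    using that by (simp add: vec_def coord_g euclidean_representation)
  \<comment> \<open>A decoded coordinate can fall outside \<open>X i\<close> when \<open>t\<close>
    codes no point. Replacing it by a fixed element of \<open>X i\<close> keeps \<open>h\<close>
    inside the product, and the case distinction is measurable because \<open>X i\<close> is
    Borel.\<close>
  define h where "h t = (\<lambda>i\<in>I. if vec t i \<in> X i then vec t i else (SOME x. x \<in> X i))" for t
  show thesis
  proof (rule that)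
    have "(\<lambda>z. of_bool (below z k)) \<in> borel_measurable (prod_borel X I)" for k
    proof -
      obtain i b q where d: "from_nat_into D k = (i, b, q)" by (cases "from_nat_into D k")
      then have "i \<in> I" using from_nat_into[OF D(2), of k] by (simp add: D_def)
      then have "(\<lambda>z. z i) \<in> prod_borel X I \<rightarrow>\<^sub>M restrict_space borel (X i)"
        unfolding prod_borel_def by (rule measurable_component_singleton)
      then have [measurable]: "(\<lambda>z. z i) \<in> borel_measurable (prod_borel X I)"
        by (simp add: measurable_restrict_space2_iff)
      show ?thesis unfolding below_def d by simp
    qed
    then show "g \<in> borel_measurable (prod_borel X I)"
      unfolding g_def ternary_code_def
      by (intro borel_measurable_suminf borel_measurable_times borel_measurable_const)
    show "h \<in> borel \<rightarrow>\<^sub>M prod_borel X I"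
      unfolding prod_borel_def
    proof (rule measurable_PiM_single')
      fix i assume i: "i \<in> I"
      note [measurable] = X(1)[OF i]
      have "(\<lambda>t. if vec t i \<in> X i then vec t i else (SOME x. x \<in> X i)) \<in> borel_measurable borel"
        by measurable
      then show "(\<lambda>t. h t i) \<in> borel \<rightarrow>\<^sub>M restrict_space borel (X i)"
        using i X(2)[OF i] by (intro measurable_restrict_space2) (auto simp: h_def some_in_eq)
    next
      show "h \<in> space borel \<rightarrow> (\<Pi>\<^sub>E i\<in>I. space (restrict_space borel (X i)))"
        using X(2) by (auto simp: h_def space_restrict_space some_in_eq)
    qed
    show "h (g z) = z" if "z \<in> PiE I X" for z
      using that by (auto simp: h_def fun_eq_iff vec_g PiE_def extensional_def)
    show "g z \<in> {0..1}" for z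
      using ternary_code_nonneg[of "below z"] ternary_code_le[of "below z"] by (simp add: g_def)
  qed
qed

subsection \<open>Measures determined by continuous functions\<close>

text \<open>The indicator of a nonempty closed set \<open>C\<close> is the pointwise limit of the
  bounded continuous functions \<open>max 0 (1 - real k * infdist x C)\<close>. Dominated
  convergence gives equal masses on closed sets, which generate the Borel sets and are stable under
  intersection.\<close>

lemma measure_eqI_continuous_integrals:
  fixes M N :: "'b::metric_space measure"
  assumes fin: "finite_measure M" "finite_measure N"
    and sets: "sets M = sets (restrict_space borel S)" "sets N = sets (restrict_space borel S)"
    and eq: "\<And>f :: 'b \<Rightarrow> real. continuous_on UNIV f \<Longrightarrow> bounded (range f) \<Longrightarrow> integral\<^sup>L M f = integral\<^sup>L N f"
  shows "M = N"
proof -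
  have space: "space M = S" "space N = S"
    using sets[THEN sets_eq_imp_space_eq] by (simp_all add: space_restrict_space)
  have meas: "f \<in> borel_measurable L" if "f \<in> borel_measurable borel" "sets L = sets (restrict_space borel S)"
    for f :: "'b \<Rightarrow> 'c::topological_space" and L
    using measurable_restrict_space1[OF that(1)] by (simp add: measurable_cong_sets[OF that(2) refl])
  have lim: "(\<lambda>k. \<integral>x. max 0 (1 - real k * infdist x C) \<partial>L) \<longlonglongrightarrow> measure L (C \<inter> space L)"
    if C: "closed C" "C \<noteq> {}" and L: "finite_measure L" "sets L = sets (restrict_space borel S)" for C L
  proof -
    interpret finite_measure L by fact
    have CL: "C \<inter> space L \<in> sets L"
    proof -
      have "space L = S" using sets_eq_imp_space_eq[OF L(2)] by (simp add: space_restrict_space)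
      then show ?thesis
        unfolding L(2) sets_restrict_space using C by (intro image_eqI[of _ _ C]) auto
    qed
    have "(\<lambda>k. \<integral>x. max 0 (1 - real k * infdist x C) \<partial>L) \<longlonglongrightarrow> (\<integral>x. indicator (C \<inter> space L) x \<partial>L)"
    proof (rule integral_dominated_convergence[where w="\<lambda>_. 1"])
      show "AE x in L. (\<lambda>k. max 0 (1 - real k * infdist x C)) \<longlonglongrightarrow> indicator (C \<inter> space L) x"
      proof (rule AE_I2)
        fix x assume x: "x \<in> space L"
        show "(\<lambda>k. max 0 (1 - real k * infdist x C)) \<longlonglongrightarrow> indicator (C \<inter> space L) x"
        proof (cases "x \<in> C")
          case True
          with x show ?thesis by simp
        next
          case False
          with C have pos: "0 < infdist x C" by (metis infdist_nonneg in_closed_iff_infdist_zero less_eq_real_def)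
          obtain k0 where k0: "1 < real k0 * infdist x C" using ex_less_of_nat_mult[OF pos] by auto
          then have "max 0 (1 - real k * infdist x C) = 0" if "k0 \<le> k" for k
          proof -
            have "real k0 * infdist x C \<le> real k * infdist x C"
              using that pos by (intro mult_right_mono) auto
            with k0 show ?thesis by simp
          qed
          then show ?thesis
            using False by (intro tendsto_eventually) (auto simp: eventually_sequentially)
        qed
      qed
      show "(\<lambda>x. max 0 (1 - real k * infdist x C)) \<in> borel_measurable L" for k
        by (rule meas[OF _ L(2)]) (intro borel_measurable_continuous_onI continuous_intros)
      show "(indicator (C \<inter> space L) :: _ \<Rightarrow> real) \<in> borel_measurable L"
        using CL by simp
    qed (auto simp: infdist_nonneg)
    then show ?thesis using CL by simp
  qed
  \<comment> \<open>The empty set is treated apart, since \<open>infdist x {}\<close> is 0 by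
    convention and the approximating functions would be constantly 1.\<close>
  have closed: "measure M (C \<inter> S) = measure N (C \<inter> S)" if "closed C" for C
  proof (cases "C = {}")
    case False
    let ?f = "\<lambda>k x. max 0 (1 - real k * infdist x C)"
    have "bounded (range (?f k))" for k
      unfolding bounded_iff by (rule exI[of _ 1]) (auto simp: infdist_nonneg)
    moreover have "continuous_on UNIV (?f k)" for k by (intro continuous_intros)
    ultimately have "integral\<^sup>L M (?f k) = integral\<^sup>L N (?f k)" for k by (rule eq[rotated])
    then show ?thesis
      using lim[OF that False fin(1) sets(1)] lim[OF that False fin(2) sets(2)]
      by (auto simp: space intro: LIMSEQ_unique)
  qed simp
  \<comment> \<open>The set \<open>S\<close> is arbitrary, so both measures are pushed forward to
    the whole space, where closed sets generate. Measurable sets of \<open>M\<close> and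
    \<open>N\<close> are traces on \<open>S\<close> of Borel sets, which brings the equality
    back.\<close>
  define L where "L K = distr K borel (\<lambda>x. x)" for K :: "'b measure"
  have id: "(\<lambda>x. x) \<in> M \<rightarrow>\<^sub>M borel" "(\<lambda>x. x) \<in> N \<rightarrow>\<^sub>M borel"
    by (rule meas[OF _ sets(1)], simp) (rule meas[OF _ sets(2)], simp)
  have "L M = L N"
  proof (rule measure_eqI_generator_eq)
    show "Int_stable {C :: 'b set. closed C}" by (auto simp: Int_stable_def)
    show "sets (L M) = sigma_sets UNIV {C. closed C}" "sets (L N) = sigma_sets UNIV {C. closed C}"
      by (simp_all add: L_def) (simp_all add: borel_eq_closed)
    show "range (\<lambda>_. UNIV) \<subseteq> {C :: 'b set. closed C}" "(\<Union>i. (\<lambda>_::nat. UNIV :: 'b set) i) = UNIV" by auto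
    show "emeasure (L M) ((\<lambda>_. UNIV) i) \<noteq> \<infinity>" for i :: nat
      using finite_measure.emeasure_finite[OF fin(1)] id by (simp add: L_def emeasure_distr)
    show "emeasure (L M) C = emeasure (L N) C" if "C \<in> {C. closed C}" for C
      using closed[of C] that id fin
      by (simp add: L_def emeasure_distr space finite_measure.emeasure_eq_measure)
  qed auto
  show ?thesis
  proof (rule measure_eqI)
    fix A assume "A \<in> sets M"
    then obtain B where B: "B \<in> sets borel" "A = B \<inter> S"
      by (auto simp: sets sets_restrict_space)
    then have "emeasure M A = emeasure (L M) B" "emeasure N A = emeasure (L N) B"
      using id by (simp_all add: L_def emeasure_distr space)
    with \<open>L M = L N\<close> show "emeasure M A = emeasure N A" by simp
  qed (simp add: sets)
qed

text \<open>The measures with densities \<open>g + B\<close> and \<open>h + B\<close> have equal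
  integrals of bounded continuous functions, so they coincide, and densities are unique almost
  everywhere.\<close>

lemma AE_eq_if_continuous_integrals_eq:
  fixes \<nu> :: "'b::metric_space measure" and g h :: "'b \<Rightarrow> real"
  assumes fin: "finite_measure \<nu>" and sets: "sets \<nu> = sets (restrict_space borel S)"
    and [measurable]: "g \<in> borel_measurable \<nu>" "h \<in> borel_measurable \<nu>"
    and bound: "\<And>x. x \<in> space \<nu> \<Longrightarrow> \<bar>g x\<bar> \<le> B" "\<And>x. x \<in> space \<nu> \<Longrightarrow> \<bar>h x\<bar> \<le> B"
    and eq: "\<And>f :: 'b \<Rightarrow> real. continuous_on UNIV f \<Longrightarrow> bounded (range f) \<Longrightarrow>
      (\<integral>x. f x * g x \<partial>\<nu>) = (\<integral>x. f x * h x \<partial>\<nu>)"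
  shows "AE x in \<nu>. g x = h x"
proof -
  interpret finite_measure \<nu> by fact
  have gB: "0 \<le> g x + B" "\<bar>g x + B\<bar> \<le> 2 * B" "0 \<le> h x + B" "\<bar>h x + B\<bar> \<le> 2 * B" if "x \<in> space \<nu>" for x
    using bound[OF that] by linarith+
  \<comment> \<open>Adding \<open>B\<close> turns \<open>g\<close> and \<open>h\<close> into nonnegative densities.\<close>
  define M where "M u = density \<nu> (\<lambda>x. ennreal (u x + B))" for u
  have M_fin: "finite_measure (M u)"
    if [measurable]: "u \<in> borel_measurable \<nu>" and u: "\<And>x. x \<in> space \<nu> \<Longrightarrow> 0 \<le> u x + B \<and> \<bar>u x + B\<bar> \<le> 2 * B" for u
  proof
    have "integrable \<nu> (\<lambda>x. u x + B)"
    proof (rule integrable_const_bound[where B="2*B"], rule AE_I2)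
      show "norm (u x + B) \<le> 2 * B" if "x \<in> space \<nu>" for x
        using u[OF that] by (simp only: real_norm_def)
    qed measurable
    moreover have "AE x in \<nu>. 0 \<le> u x + B" using u by auto
    ultimately have "(\<integral>\<^sup>+x. ennreal (u x + B) \<partial>\<nu>) = ennreal (\<integral>x. u x + B \<partial>\<nu>)"
      by (rule nn_integral_eq_integral)
    then show "emeasure (M u) (space (M u)) \<noteq> \<infinity>"
      by (simp add: M_def emeasure_density cong: nn_integral_cong)
  qed
  have "M g = M h"
  proof (rule measure_eqI_continuous_integrals)
    fix f :: "'b \<Rightarrow> real" assume f: "continuous_on UNIV f" "bounded (range f)"
    then obtain F where F: "\<And>x. \<bar>f x\<bar> \<le> F" by (auto simp: bounded_iff)
    have "f \<in> borel_measurable (restrict_space borel S)"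
      using f by (intro measurable_restrict_space1 borel_measurable_continuous_onI)
    then have [measurable]: "f \<in> borel_measurable \<nu>" by (simp add: measurable_cong_sets[OF sets refl])
    have int: "integrable \<nu> (\<lambda>x. f x * u x)"
      if [measurable]: "u \<in> borel_measurable \<nu>" and u: "\<And>x. x \<in> space \<nu> \<Longrightarrow> \<bar>u x\<bar> \<le> B" for u
    proof (rule integrable_const_bound[where B="F * B"], rule AE_I2)
      show "norm (f x * u x) \<le> F * B" if "x \<in> space \<nu>" for x
        unfolding real_norm_def abs_mult
        using F[of x] u[OF that] by (intro mult_mono) linarith+
    qed measurable
    have intf: "integrable \<nu> f"
      using F by (intro integrable_const_bound[where B=F] AE_I2) (simp_all only: real_norm_def, measurable)
    have dens: "integral\<^sup>L (M u) f = (\<integral>x. f x * u x \<partial>\<nu>) + (\<integral>x. f x \<partial>\<nu>) * B"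
      if [measurable]: "u \<in> borel_measurable \<nu>" and u: "\<And>x. x \<in> space \<nu> \<Longrightarrow> \<bar>u x\<bar> \<le> B"
        "\<And>x. x \<in> space \<nu> \<Longrightarrow> 0 \<le> u x + B" for u
    proof -
      have "integral\<^sup>L (M u) f = (\<integral>x. (u x + B) *\<^sub>R f x \<partial>\<nu>)"
        unfolding M_def using u by (intro integral_density) auto
      also have "\<dots> = (\<integral>x. f x * u x + f x * B \<partial>\<nu>)"
        by (simp add: algebra_simps)
      also have "\<dots> = (\<integral>x. f x * u x \<partial>\<nu>) + (\<integral>x. f x \<partial>\<nu>) * B"
        using int[of u] u intf by simp
      finally show ?thesis .
    qed
    show "integral\<^sup>L (M g) f = integral\<^sup>L (M h) f"
      using eq[OF f] bound gB by (simp add: dens)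
  next
    show "finite_measure (M g)" "finite_measure (M h)"
      using gB by (blast intro: M_fin assms(3,4))+
  qed (simp_all add: M_def sets)
  then have "AE x in \<nu>. ennreal (g x + B) = ennreal (h x + B)"
    unfolding M_def by (subst (asm) density_unique_iff) auto
  with AE_space show ?thesis
    by eventually_elim (use gB in auto)
qed

subsection \<open>Martingale couplings\<close>

lemma borel_measurable_prod_borel_coordinate:
  fixes X :: "nat \<Rightarrow> 'a::euclidean_space set"
  assumes "i \<in> I"
  shows "(\<lambda>x. x i) \<in> borel_measurable (prod_borel X I)"
proof -
  have "(\<lambda>x. x i) \<in> prod_borel X I \<rightarrow>\<^sub>M restrict_space borel (X i)"
    unfolding prod_borel_def using assms by (rule measurable_component_singleton)
  then show ?thesis by (simp add: measurable_restrict_space2_iff)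
qed

lemma measurable_restrict_prod_borel:
  assumes "J \<subseteq> I"
  shows "(\<lambda>x. restrict x J) \<in> prod_borel X I \<rightarrow>\<^sub>M prod_borel X J"
  unfolding prod_borel_def using assms by (rule measurable_restrict_subset)

text \<open>Restriction to \<open>I\<close> and \<open>J\<close> identifies the product over
  \<open>I \<union> J\<close> with a pair product, with \<open>merge\<close> as the inverse. The
  disintegration of the pair is carried back along \<open>merge\<close>.\<close>

lemma disintegration_exists:
  fixes X :: "nat \<Rightarrow> 'a::euclidean_space set"
  assumes \<pi>: "\<pi> \<in> space (prob_algebra (prod_borel X (I \<union> J)))"
    and "I \<inter> J = {}" and X: "\<And>j. j \<in> J \<Longrightarrow> X j \<in> sets borel"
  obtains \<kappa> where "disintegration X I J \<pi> \<kappa>"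
proof -
  from \<pi> have sets_\<pi>[measurable_cong]: "sets \<pi> = sets (prod_borel X (I \<union> J))" and "prob_space \<pi>"
    by (auto simp: space_prob_algebra)
  interpret \<pi>: prob_space \<pi> by fact
  have space_\<pi>: "space \<pi> = PiE (I \<union> J) X"
    using sets_eq_imp_space_eq[OF sets_\<pi>] by simp
  \<comment> \<open>A probability measure lives on a nonempty space, so no factor of the product is
    empty.\<close>
  have X_ne: "X j \<noteq> {}" if "j \<in> J" for j
    using \<pi>.not_empty that by (auto simp: space_\<pi> PiE_eq_empty_iff)
  obtain g :: "(nat \<Rightarrow> 'a) \<Rightarrow> real" and h where
    g: "g \<in> prod_borel X J \<rightarrow>\<^sub>M borel" and h: "h \<in> borel \<rightarrow>\<^sub>M prod_borel X J"
    and gh: "\<And>z. z \<in> PiE J X \<Longrightarrow> h (g z) = z" "\<And>z. z \<in> PiE J X \<Longrightarrow> g z \<in> {0..1}"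
    by (rule prod_borel_retract_of_unit_interval[where I=J and X=X]) (auto simp: X X_ne)
  let ?N = "prod_borel X I" and ?S = "prod_borel X J"
  have [measurable]: "(\<lambda>x. restrict x I) \<in> prod_borel X (I \<union> J) \<rightarrow>\<^sub>M ?N"
    "(\<lambda>x. restrict x J) \<in> prod_borel X (I \<union> J) \<rightarrow>\<^sub>M ?S"
    by (auto intro: measurable_restrict_prod_borel)
  have merge[measurable]: "merge I J \<in> ?N \<Otimes>\<^sub>M ?S \<rightarrow>\<^sub>M prod_borel X (I \<union> J)"
    unfolding prod_borel_def by (rule measurable_merge)
  define \<rho> where "\<rho> = distr \<pi> (?N \<Otimes>\<^sub>M ?S) (\<lambda>x. (restrict x I, restrict x J))"
  have "\<rho> \<in> space (prob_algebra (?N \<Otimes>\<^sub>M ?S))"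
    by (simp add: \<rho>_def space_prob_algebra) (intro \<pi>.prob_space_distr, measurable)
  then obtain \<kappa> where \<kappa>[measurable]: "\<kappa> \<in> ?N \<rightarrow>\<^sub>M prob_algebra ?S"
    and \<rho>: "\<rho> = distr \<rho> ?N fst \<bind> (\<lambda>y. distr (\<kappa> y) (?N \<Otimes>\<^sub>M ?S) (Pair y))"
    by (rule disintegration_retract_of_unit_interval[OF _ g h]) (simp_all only: space_prod_borel gh)
  have fst_\<rho>: "distr \<rho> ?N fst = Proj X I \<pi>"
    unfolding \<rho>_def Proj_def by (subst distr_distr) (auto simp: comp_def)
  have ne: "space (Proj X I \<pi>) \<noteq> {}"
    using \<pi>.not_empty by (auto simp: Proj_def space_\<pi> PiE_eq_empty_iff)
  show thesis
  proof (rule that, unfold disintegration_def, intro conjI)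
    show "\<kappa> \<in> ?N \<rightarrow>\<^sub>M prob_algebra ?S" by (rule \<kappa>)
    have "\<pi> = distr \<rho> (prod_borel X (I \<union> J)) (merge I J)"
    proof -
      have eq: "merge I J (restrict x I, restrict x J) = x" if "x \<in> PiE (I \<union> J) X" for x
        using that \<open>I \<inter> J = {}\<close> by (auto simp: merge_def fun_eq_iff PiE_def extensional_def)
      have "distr \<rho> (prod_borel X (I \<union> J)) (merge I J) = distr \<pi> (prod_borel X (I \<union> J)) (\<lambda>z. z)"
        unfolding \<rho>_def by (subst distr_distr) (auto intro!: distr_cong simp: space_\<pi> eq)
      also have "\<dots> = \<pi>" by (rule distr_id2) (simp add: sets_\<pi>)
      finally show ?thesis by simp
    qed
    also have "\<dots> = Proj X I \<pi> \<bind>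
        (\<lambda>y. distr (distr (\<kappa> y) (?N \<Otimes>\<^sub>M ?S) (Pair y)) (prod_borel X (I \<union> J)) (merge I J))"
    proof -
      have "(\<lambda>y. distr (\<kappa> y) (?N \<Otimes>\<^sub>M ?S) (Pair y)) \<in> Proj X I \<pi> \<rightarrow>\<^sub>M subprob_algebra (?N \<Otimes>\<^sub>M ?S)"
        unfolding Proj_def by (intro measurable_prob_algebraD) measurable
      from distr_bind[OF this ne merge] show ?thesis
        by (subst \<rho>) (simp add: fst_\<rho>)
    qed
    also have "\<dots> = Proj X I \<pi> \<bind> (\<lambda>x. distr (\<kappa> x) (prod_borel X (I \<union> J)) (\<lambda>y. merge I J (x, y)))"
    proof (rule bind_cong[OF refl])
      fix y assume "y \<in> space (Proj X I \<pi>)"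
      then have y: "y \<in> space ?N" by (simp add: Proj_def)
      have [measurable_cong]: "sets (\<kappa> y) = sets ?S"
        using measurable_space[OF \<kappa> y] by (simp add: space_prob_algebra)
      show "distr (distr (\<kappa> y) (?N \<Otimes>\<^sub>M ?S) (Pair y)) (prod_borel X (I \<union> J)) (merge I J)
          = distr (\<kappa> y) (prod_borel X (I \<union> J)) (\<lambda>z. merge I J (y, z))"
        using y by (subst distr_distr) (auto simp: comp_def)
    qed
    finally show "\<pi> = \<dots>" .
  qed
qed

lemma borel_measurable_kernel_mean:
  fixes X :: "nat \<Rightarrow> 'a::euclidean_space set"
  assumes "\<kappa> \<in> N \<rightarrow>\<^sub>M prob_algebra (prod_borel X J)" "j \<in> J"
  shows "(\<lambda>x. \<integral>y. y j \<partial>\<kappa> x) \<in> borel_measurable N"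
  using measurable_prob_algebraD[OF assms(1)]
    integral_measurable_subprob_algebra[OF borel_measurable_prod_borel_coordinate[OF assms(2), of X]]
  by (rule measurable_compose)

lemma integrable_coordinate:
  fixes X :: "nat \<Rightarrow> 'a::euclidean_space set"
  assumes P: "P \<in> space (prob_algebra (prod_borel X J))" and j: "j \<in> J"
    and C: "\<And>x. x \<in> X j \<Longrightarrow> norm x \<le> C"
  shows "integrable P (\<lambda>y. y j)" "norm (\<integral>y. y j \<partial>P) \<le> C"
proof -
  from P have sets: "sets P = sets (prod_borel X J)" and "prob_space P"
    by (auto simp: space_prob_algebra)
  interpret prob_space P by fact
  have "(\<lambda>y. y j) \<in> borel_measurable P"
    unfolding measurable_cong_sets[OF sets refl]
    using j by (rule borel_measurable_prod_borel_coordinate)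
  moreover have bound: "AE y in P. norm (y j) \<le> C"
    using sets_eq_imp_space_eq[OF sets] C j by (intro AE_I2) auto
  ultimately show int: "integrable P (\<lambda>y. y j)"
    by (intro integrable_const_bound)
  have "norm (\<integral>y. y j \<partial>P) \<le> (\<integral>y. norm (y j) \<partial>P)" by (rule integral_norm_bound)
  also have "\<dots> \<le> C" using int bound by (intro integral_le_const) auto
  finally show "norm (\<integral>y. y j \<partial>P) \<le> C" .
qed

text \<open>Fubini for a kernel; the bound on \<open>\<phi>\<close> makes all integrals
  finite.\<close>

lemma integral_disintegration:
  fixes \<phi> :: "(nat \<Rightarrow> 'a::euclidean_space) \<Rightarrow> real"
  assumes dis: "disintegration X I J \<pi> \<kappa>" and "prob_space (Proj X I \<pi>)"
    and \<phi>: "\<phi> \<in> borel_measurable (prod_borel X (I \<union> J))"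
      "\<And>z. z \<in> PiE (I \<union> J) X \<Longrightarrow> \<bar>\<phi> z\<bar> \<le> B"
  shows "integral\<^sup>L \<pi> \<phi> = (\<integral>x. (\<integral>y. \<phi> (merge I J (x, y)) \<partial>\<kappa> x) \<partial>Proj X I \<pi>)"
proof -
  let ?N = "prod_borel X I" and ?S = "prod_borel X J"
  let ?K = "\<lambda>x. distr (\<kappa> x) (prod_borel X (I \<union> J)) (\<lambda>y. merge I J (x, y))"
  interpret P: prob_space "Proj X I \<pi>" by fact
  from dis have \<kappa>[measurable]: "\<kappa> \<in> ?N \<rightarrow>\<^sub>M prob_algebra ?S" and \<pi>: "\<pi> = Proj X I \<pi> \<bind> ?K"
    by (auto simp: disintegration_def)
  have merge[measurable]: "merge I J \<in> ?N \<Otimes>\<^sub>M ?S \<rightarrow>\<^sub>M prod_borel X (I \<union> J)"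
    unfolding prod_borel_def by (rule measurable_merge)
  have K[measurable]: "?K \<in> ?N \<rightarrow>\<^sub>M prob_algebra (prod_borel X (I \<union> J))"
    by measurable
  have K': "?K \<in> Proj X I \<pi> \<rightarrow>\<^sub>M prob_algebra (prod_borel X (I \<union> J))"
    unfolding Proj_def by measurable
  have "integral\<^sup>L \<pi> \<phi> = (\<integral>x. integral\<^sup>L (?K x) \<phi> \<partial>Proj X I \<pi>)"
  proof (subst \<pi>, rule integral_bind[where B=B and B'=1])
    show "AE x in Proj X I \<pi>. emeasure (?K x) (space (?K x)) \<le> ennreal 1"
      using measurable_space[OF K']
      by (intro AE_I2) (simp add: space_prob_algebra prob_space.emeasure_le_1)
  qed (use \<phi> K' P.finite_measure_axioms in \<open>auto intro: measurable_prob_algebraD\<close>)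
  also have "\<dots> = (\<integral>x. (\<integral>y. \<phi> (merge I J (x, y)) \<partial>\<kappa> x) \<partial>Proj X I \<pi>)"
  proof (rule Bochner_Integration.integral_cong[OF refl])
    fix x assume "x \<in> space (Proj X I \<pi>)"
    then have x: "x \<in> space ?N" by (simp add: Proj_def)
    have [measurable_cong]: "sets (\<kappa> x) = sets ?S"
      using measurable_space[OF \<kappa> x] by (simp add: space_prob_algebra)
    show "integral\<^sup>L (?K x) \<phi> = (\<integral>y. \<phi> (merge I J (x, y)) \<partial>\<kappa> x)"
      using x \<phi>(1) by (intro integral_distr) auto
  qed
  finally show ?thesis .
qed

text \<open>Tychonoff applies once the condition of being \<open>undefined\<close> outside
  \<open>I\<close> is written as a singleton factor.\<close>

lemma compact_PiE:
  fixes X :: "'i \<Rightarrow> 'b::topological_space set"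
  assumes "\<And>i. i \<in> I \<Longrightarrow> compact (X i)"
  shows "compact (PiE I X)"
proof -
  have "PiE I X = PiE UNIV (\<lambda>i. if i \<in> I then X i else {undefined})"
    by (auto simp: PiE_def Pi_def extensional_def split: if_splits)
  moreover have "compactin (product_topology (\<lambda>_. euclidean) UNIV) \<dots>"
    using assms by (subst compactin_PiE) auto
  ultimately show ?thesis by (simp add: euclidean_product_topology)
qed

lemma prob_space_Proj:
  assumes "\<pi> \<in> space (prob_algebra (prod_borel X K))" "I \<subseteq> K"
  shows "prob_space (Proj X I \<pi>)"
proof -
  from assms(1) have sets: "sets \<pi> = sets (prod_borel X K)" and "prob_space \<pi>"
    by (auto simp: space_prob_algebra)
  then show ?thesis
    unfolding Proj_def using measurable_restrict_prod_borel[OF assms(2), of X]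
    by (intro prob_space.prob_space_distr) (simp_all add: measurable_cong_sets[OF sets refl])
qed

text \<open>The tower property: under the kernel at \<open>x\<close> the coordinates in
  \<open>I\<close> are frozen at \<open>x\<close>, so \<open>f\<close> comes out of the inner
  integral.\<close>

lemma integral_conditional_mean:
  fixes X :: "nat \<Rightarrow> 'a::euclidean_space set"
  assumes \<pi>: "\<pi> \<in> space (prob_algebra (prod_borel X (I \<union> J)))"
    and disj: "I \<inter> J = {}" and j: "j \<in> J" and bdd: "bounded (X j)"
    and dis: "disintegration X I J \<pi> \<kappa>"
    and f[measurable]: "f \<in> borel_measurable (prod_borel X I)"
    and F: "\<And>x. x \<in> PiE I X \<Longrightarrow> \<bar>f x\<bar> \<le> F"
  shows "(\<integral>z. f (restrict z I) * (z j \<bullet> b) \<partial>\<pi>) = (\<integral>x. f x * ((\<integral>y. y j \<partial>\<kappa> x) \<bullet> b) \<partial>Proj X I \<pi>)"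
proof -
  from bdd obtain C where C: "\<And>x. x \<in> X j \<Longrightarrow> norm x \<le> C" by (auto simp: bounded_iff)
  from dis have \<kappa>: "\<kappa> \<in> prod_borel X I \<rightarrow>\<^sub>M prob_algebra (prod_borel X J)"
    by (auto simp: disintegration_def)
  have [measurable]: "(\<lambda>z. restrict z I) \<in> prod_borel X (I \<union> J) \<rightarrow>\<^sub>M prod_borel X I"
    by (intro measurable_restrict_prod_borel) auto
  have [measurable]: "(\<lambda>z. z j) \<in> borel_measurable (prod_borel X (I \<union> J))"
    using j by (intro borel_measurable_prod_borel_coordinate) auto
  have "(\<integral>z. f (restrict z I) * (z j \<bullet> b) \<partial>\<pi>)
      = (\<integral>x. (\<integral>y. f (restrict (merge I J (x, y)) I) * (merge I J (x, y) j \<bullet> b) \<partial>\<kappa> x) \<partial>Proj X I \<pi>)"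
  proof (rule integral_disintegration[OF dis, where B="F * (C * norm b)"])
    show "prob_space (Proj X I \<pi>)" using \<pi> by (rule prob_space_Proj) auto
    show "(\<lambda>z. f (restrict z I) * (z j \<bullet> b)) \<in> borel_measurable (prod_borel X (I \<union> J))"
      by measurable
    fix z assume z: "z \<in> PiE (I \<union> J) X"
    then have "restrict z I \<in> PiE I X" "z j \<in> X j" using j by auto
    with F C have "\<bar>f (restrict z I)\<bar> \<le> F" "norm (z j) \<le> C" by auto
    moreover have "\<bar>z j \<bullet> b\<bar> \<le> norm (z j) * norm b" by (rule Cauchy_Schwarz_ineq2)
    moreover have "norm (z j) * norm b \<le> C * norm b"
      using calculation by (intro mult_right_mono) auto
    ultimately show "\<bar>f (restrict z I) * (z j \<bullet> b)\<bar> \<le> F * (C * norm b)"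
      unfolding abs_mult by (intro mult_mono) linarith+
  qed
  also have "\<dots> = (\<integral>x. f x * ((\<integral>y. y j \<partial>\<kappa> x) \<bullet> b) \<partial>Proj X I \<pi>)"
  proof (rule Bochner_Integration.integral_cong[OF refl])
    fix x assume "x \<in> space (Proj X I \<pi>)"
    then have x: "x \<in> PiE I X" by (simp add: Proj_def)
    then have int: "integrable (\<kappa> x) (\<lambda>y. y j)"
      using measurable_space[OF \<kappa>, of x] j C by (intro integrable_coordinate(1)[of _ X J]) auto
    have "restrict (merge I J (x, y)) I = x" "merge I J (x, y) j = y j" for y
      using x j disj by (auto simp: fun_eq_iff merge_def PiE_def extensional_def)
    then show "(\<integral>y. f (restrict (merge I J (x, y)) I) * (merge I J (x, y) j \<bullet> b) \<partial>\<kappa> x)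
        = f x * ((\<integral>y. y j \<partial>\<kappa> x) \<bullet> b)"
      using int by simp
  qed
  finally show ?thesis .
qed

section \<open>Testing the martingale property with continuous functions\<close>

text \<open>Both sides of a test are integrals of \<open>f\<close> over the first \<open>i\<close>
  coordinates, one against the conditional mean of the next coordinate and one against the present
  coordinate. Bounded continuous \<open>f\<close> determine such functions almost everywhere. The
  tests contain no kernel, which is what makes them fit for weak limits.\<close>

lemma martingale_couplings_iff:
  fixes X :: "nat \<Rightarrow> 'a::euclidean_space set"
  assumes X: "\<And>i. i \<in> {1..n} \<Longrightarrow> compact (X i)" and \<pi>: "\<pi> \<in> couplings n X \<mu>"
  shows "\<pi> \<in> martingale_couplings n X \<mu> \<longleftrightarrow>
    (\<forall>i\<in>{1..<n}. \<forall>b\<in>Basis. \<forall>f :: (nat \<Rightarrow> 'a) \<Rightarrow> real.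
      continuous_on UNIV f \<longrightarrow> bounded (range f) \<longrightarrow>
      (\<integral>z. f (restrict z {1..i}) * (z (i+1) \<bullet> b) \<partial>\<pi>) = (\<integral>z. f (restrict z {1..i}) * (z i \<bullet> b) \<partial>\<pi>))"
    (is "_ \<longleftrightarrow> (\<forall>i\<in>_. \<forall>b\<in>_. \<forall>f. _ \<longrightarrow> _ \<longrightarrow> ?test i b f)")
proof -
  have \<pi>': "\<pi> \<in> space (prob_algebra (prod_borel X {1..n}))"
    using \<pi> by (simp add: couplings_def)
  then have sets_\<pi>: "sets \<pi> = sets (prod_borel X {1..n})" by (simp add: space_prob_algebra)
  have "(\<exists>\<kappa>. disintegration X {1..i} {i+1..n} \<pi> \<kappa> \<and>
        (AE x in Proj X {1..i} \<pi>. (\<integral>y. y (i+1) \<partial>\<kappa> x) = x i)) \<longleftrightarrow>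
      (\<forall>b\<in>Basis. \<forall>f. continuous_on UNIV f \<longrightarrow> bounded (range f) \<longrightarrow> ?test i b f)"
    if i: "i \<in> {1..<n}" for i
  proof -
    let ?I = "{1..i}" and ?J = "{i+1..n}"
    let ?\<nu> = "Proj X ?I \<pi>"
    have IJ: "{1..n} = ?I \<union> ?J" "?I \<inter> ?J = {}" using i by auto
    note \<pi>IJ = \<pi>'[unfolded IJ(1)]
    have sets_\<nu>: "sets ?\<nu> = sets (prod_borel X ?I)" by (simp add: Proj_def)
    have space_\<nu>: "space ?\<nu> = PiE ?I X" by (simp add: Proj_def)
    interpret \<nu>: prob_space ?\<nu> using \<pi>' i by (intro prob_space_Proj) auto
    have coord: "(\<lambda>x. x i) \<in> borel_measurable (prod_borel X ?I)"
      using i by (intro borel_measurable_prod_borel_coordinate) auto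
    have f_meas: "f \<in> borel_measurable (prod_borel X ?I)" if "continuous_on UNIV f"
      for f :: "(nat \<Rightarrow> 'a) \<Rightarrow> real"
      unfolding measurable_cong_sets[OF sets_prod_borel refl]
      using that by (intro measurable_restrict_space1 borel_measurable_continuous_onI)
    obtain C0 C1 where C: "\<And>x. x \<in> X i \<Longrightarrow> norm x \<le> C0" "\<And>x. x \<in> X (i+1) \<Longrightarrow> norm x \<le> C1"
      using X[of i] X[of "i+1"] i by (force dest!: compact_imp_bounded simp: bounded_iff)
    have mean: "(\<lambda>x. \<integral>y. y (i+1) \<partial>\<kappa> x) \<in> borel_measurable ?\<nu>"
      "x \<in> space ?\<nu> \<Longrightarrow> norm (\<integral>y. y (i+1) \<partial>\<kappa> x) \<le> C1"
      if "disintegration X ?I ?J \<pi> \<kappa>" for \<kappa> x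
    proof -
      from that have \<kappa>: "\<kappa> \<in> prod_borel X ?I \<rightarrow>\<^sub>M prob_algebra (prod_borel X ?J)"
        by (simp add: disintegration_def)
      show "(\<lambda>x. \<integral>y. y (i+1) \<partial>\<kappa> x) \<in> borel_measurable ?\<nu>"
        unfolding measurable_cong_sets[OF sets_\<nu> refl]
        using i by (intro borel_measurable_kernel_mean[OF \<kappa>]) auto
      show "norm (\<integral>y. y (i+1) \<partial>\<kappa> x) \<le> C1" if "x \<in> space ?\<nu>"
      proof (rule integrable_coordinate(2))
        show "\<kappa> x \<in> space (prob_algebra (prod_borel X ?J))"
          using that unfolding space_\<nu> by (intro measurable_space[OF \<kappa>]) simp
      qed (use i C(2) in auto)
    qed
    have next_step: "(\<integral>z. f (restrict z ?I) * (z (i+1) \<bullet> b) \<partial>\<pi>)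
        = (\<integral>x. f x * ((\<integral>y. y (i+1) \<partial>\<kappa> x) \<bullet> b) \<partial>?\<nu>)"
      if dis: "disintegration X ?I ?J \<pi> \<kappa>" and f: "continuous_on UNIV f" "bounded (range f)" for \<kappa> f b
    proof -
      obtain F where "\<And>x. \<bar>f x\<bar> \<le> F" using f by (auto simp: bounded_iff)
      then show ?thesis
        using i X[of "i+1"]
        by (intro integral_conditional_mean[OF \<pi>IJ IJ(2) _ _ dis f_meas[OF f(1)]])
           (auto intro: compact_imp_bounded)
    qed
    have this_step: "(\<integral>z. f (restrict z ?I) * (z i \<bullet> b) \<partial>\<pi>) = (\<integral>x. f x * (x i \<bullet> b) \<partial>?\<nu>)"
      if f: "continuous_on UNIV f" for f b
    proof -
      have "(\<integral>x. f x * (x i \<bullet> b) \<partial>?\<nu>) = (\<integral>z. f (restrict z ?I) * (restrict z ?I i \<bullet> b) \<partial>\<pi>)"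
        unfolding Proj_def
      proof (rule integral_distr)
        show "(\<lambda>x. restrict x ?I) \<in> \<pi> \<rightarrow>\<^sub>M prod_borel X ?I"
          unfolding measurable_cong_sets[OF sets_\<pi> refl]
          using i by (intro measurable_restrict_prod_borel) auto
        show "(\<lambda>x. f x * (x i \<bullet> b)) \<in> borel_measurable (prod_borel X ?I)"
          using coord f_meas[OF f] by measurable
      qed
      then show ?thesis using i by simp
    qed
    show ?thesis
    proof
      assume "\<exists>\<kappa>. disintegration X ?I ?J \<pi> \<kappa> \<and> (AE x in ?\<nu>. (\<integral>y. y (i+1) \<partial>\<kappa> x) = x i)"
      then obtain \<kappa> where dis: "disintegration X ?I ?J \<pi> \<kappa>"
        and mart: "AE x in ?\<nu>. (\<integral>y. y (i+1) \<partial>\<kappa> x) = x i" by blast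
      have meas_mean: "(\<lambda>x. \<integral>y. y (i+1) \<partial>\<kappa> x) \<in> borel_measurable ?\<nu>"
        by (rule mean(1)[OF dis])
      show "\<forall>b\<in>Basis. \<forall>f. continuous_on UNIV f \<longrightarrow> bounded (range f) \<longrightarrow> ?test i b f"
      proof (intro ballI allI impI)
        fix b and f :: "(nat \<Rightarrow> 'a) \<Rightarrow> real"
        assume f: "continuous_on UNIV f" "bounded (range f)"
        have "(\<integral>x. f x * ((\<integral>y. y (i+1) \<partial>\<kappa> x) \<bullet> b) \<partial>?\<nu>) = (\<integral>x. f x * (x i \<bullet> b) \<partial>?\<nu>)"
        proof (rule integral_cong_AE)
          have [measurable]: "f \<in> borel_measurable ?\<nu>" "(\<lambda>x. x i) \<in> borel_measurable ?\<nu>"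
            "(\<lambda>x. \<integral>y. y (i+1) \<partial>\<kappa> x) \<in> borel_measurable ?\<nu>"
            using coord f_meas[OF f(1)] meas_mean by (simp_all only: measurable_cong_sets[OF sets_\<nu> refl])
          show "(\<lambda>x. f x * ((\<integral>y. y (i+1) \<partial>\<kappa> x) \<bullet> b)) \<in> borel_measurable ?\<nu>"
            "(\<lambda>x. f x * (x i \<bullet> b)) \<in> borel_measurable ?\<nu>"
            by measurable
          show "AE x in ?\<nu>. f x * ((\<integral>y. y (i+1) \<partial>\<kappa> x) \<bullet> b) = f x * (x i \<bullet> b)"
            using mart by eventually_elim simp
        qed
        then show "?test i b f"
          using next_step[OF dis f] this_step[OF f(1)] by simp
      qed
    next
      assume test: "\<forall>b\<in>Basis. \<forall>f. continuous_on UNIV f \<longrightarrow> bounded (range f) \<longrightarrow> ?test i b f"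
      have XJ: "X j \<in> sets borel" if "j \<in> ?J" for j
        using X that i by (intro borel_closed compact_imp_closed) auto
      obtain \<kappa> where dis: "disintegration X ?I ?J \<pi> \<kappa>"
        by (rule disintegration_exists[OF \<pi>IJ IJ(2) XJ])
      have meas_mean: "(\<lambda>x. \<integral>y. y (i+1) \<partial>\<kappa> x) \<in> borel_measurable ?\<nu>"
        by (rule mean(1)[OF dis])
      have mean_bound: "norm (\<integral>y. y (i+1) \<partial>\<kappa> x) \<le> C1" if "x \<in> space ?\<nu>" for x
        using that by (rule mean(2)[OF dis])
      \<comment> \<open>The kernel was an arbitrary disintegration; its mean is identified one basis
        vector at a time. The finitely many null sets are united afterwards.\<close>
      have "AE x in ?\<nu>. (\<integral>y. y (i+1) \<partial>\<kappa> x) \<bullet> b = x i \<bullet> b" if b: "b \<in> Basis" for b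
      proof (rule AE_eq_if_continuous_integrals_eq[where S="PiE ?I X" and B="max C0 C1"])
        show "finite_measure ?\<nu>" by unfold_locales
        show "sets ?\<nu> = sets (restrict_space borel (PiE ?I X))"
          unfolding sets_\<nu> by (rule sets_prod_borel)
        show "(\<lambda>x. (\<integral>y. y (i+1) \<partial>\<kappa> x) \<bullet> b) \<in> borel_measurable ?\<nu>"
          using meas_mean by measurable
        show "(\<lambda>x. x i \<bullet> b) \<in> borel_measurable ?\<nu>"
          unfolding measurable_cong_sets[OF sets_\<nu> refl] using coord by measurable
        show "\<bar>(\<integral>y. y (i+1) \<partial>\<kappa> x) \<bullet> b\<bar> \<le> max C0 C1" if "x \<in> space ?\<nu>" for x
          using Basis_le_norm[OF b, of "\<integral>y. y (i+1) \<partial>\<kappa> x"] mean_bound[OF that] by linarith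
        show "\<bar>x i \<bullet> b\<bar> \<le> max C0 C1" if "x \<in> space ?\<nu>" for x
        proof -
          have "x i \<in> X i" using that i unfolding space_\<nu> by auto
          then show ?thesis using Basis_le_norm[OF b, of "x i"] C(1)[of "x i"] by linarith
        qed
        fix f :: "(nat \<Rightarrow> 'a) \<Rightarrow> real" assume f: "continuous_on UNIV f" "bounded (range f)"
        show "(\<integral>x. f x * ((\<integral>y. y (i+1) \<partial>\<kappa> x) \<bullet> b) \<partial>?\<nu>) = (\<integral>x. f x * (x i \<bullet> b) \<partial>?\<nu>)"
          using test b f next_step[OF dis f, of b] this_step[OF f(1), of b] by simp
      qed
      then have "AE x in ?\<nu>. \<forall>b\<in>Basis. (\<integral>y. y (i+1) \<partial>\<kappa> x) \<bullet> b = x i \<bullet> b"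
        by (subst AE_ball_countable) (auto simp: countable_finite)
      then have "AE x in ?\<nu>. (\<integral>y. y (i+1) \<partial>\<kappa> x) = x i"
        by eventually_elim (auto intro: euclidean_eqI)
      with dis show "\<exists>\<kappa>. disintegration X ?I ?J \<pi> \<kappa> \<and> (AE x in ?\<nu>. (\<integral>y. y (i+1) \<partial>\<kappa> x) = x i)"
        by blast
    qed
  qed
  with \<pi> show ?thesis by (simp add: martingale_couplings_def)
qed

subsection \<open>Weak limits\<close>

text \<open>Compactness bounds \<open>f\<close>, and \<open>sets_prod_borel\<close> turns continuity
  on the product into measurability.\<close>

lemma integrable_continuous_on_compact_PiE:
  fixes X :: "nat \<Rightarrow> 'a::euclidean_space set" and f :: "(nat \<Rightarrow> 'a) \<Rightarrow> real"
  assumes X: "\<And>i. i \<in> I \<Longrightarrow> compact (X i)" and f: "continuous_on (PiE I X) f"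
    and \<pi>: "\<pi> \<in> space (prob_algebra (prod_borel X I))"
  shows "integrable \<pi> f"
proof -
  from \<pi> have sets: "sets \<pi> = sets (prod_borel X I)" and "prob_space \<pi>"
    by (auto simp: space_prob_algebra)
  interpret prob_space \<pi> by fact
  have "bounded (f ` PiE I X)"
    using compact_continuous_image[OF f compact_PiE] X by (blast intro: compact_imp_bounded)
  then obtain B where B: "\<And>x. x \<in> PiE I X \<Longrightarrow> norm (f x) \<le> B" by (auto simp: bounded_iff)
  have "f \<in> borel_measurable \<pi>"
    unfolding measurable_cong_sets[OF sets refl] measurable_cong_sets[OF sets_prod_borel refl]
    using f by (rule borel_measurable_continuous_on_restrict)
  moreover have "AE x in \<pi>. norm (f x) \<le> B"
    using sets_eq_imp_space_eq[OF sets] B by (intro AE_I2) auto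
  ultimately show ?thesis by (intro integrable_const_bound)
qed

lemma continuous_on_coordinate: "continuous_on A (\<lambda>z. z j :: 'b::topological_space)"
  by (rule continuous_on_subset[OF continuous_on_product_coordinates]) simp

lemma weak_conv_onD:
  fixes f :: "'b::topological_space \<Rightarrow> real"
  assumes "weak_conv_on S \<rho> \<pi>" "continuous_on S f" "compact S"
  shows "(\<lambda>k. \<integral>x. f x \<partial>\<rho> k) \<longlonglongrightarrow> (\<integral>x. f x \<partial>\<pi>)"
proof -
  have "bounded (f ` S)"
    using assms(2,3) by (intro compact_imp_bounded compact_continuous_image)
  with assms(2) show ?thesis
    using assms(1)[unfolded weak_conv_on_def, rule_format, of f] by simp
qed

text \<open>A continuous function of one coordinate is continuous on the product. Its integrals
  along the sequence are all equal to the integral against \<open>\<mu> i\<close>, hence so is the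
  limit.\<close>

lemma couplings_weakly_closed:
  fixes X :: "nat \<Rightarrow> 'a::euclidean_space set"
  assumes X: "\<And>i. i \<in> {1..n} \<Longrightarrow> compact (X i)"
    and \<rho>: "\<And>k. \<rho> k \<in> couplings n X \<mu>"
    and \<pi>: "\<pi> \<in> space (prob_algebra (prod_borel X {1..n}))"
    and conv: "weak_conv_on (PiE {1..n} X) \<rho> \<pi>"
  shows "\<pi> \<in> couplings n X \<mu>"
proof -
  have K: "compact (PiE {1..n} X)" using X by (rule compact_PiE)
  have "distr \<pi> (restrict_space borel (X i)) (\<lambda>x. x i) = \<mu> i" if i: "i \<in> {1..n}" for i
  proof -
    let ?R = "restrict_space borel (X i)"
    have meas: "(\<lambda>x. x i) \<in> \<sigma> \<rightarrow>\<^sub>M ?R" "prob_space \<sigma>"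
      if "\<sigma> \<in> space (prob_algebra (prod_borel X {1..n}))" for \<sigma>
    proof -
      from that have sets: "sets \<sigma> = sets (prod_borel X {1..n})" by (simp add: space_prob_algebra)
      show "(\<lambda>x. x i) \<in> \<sigma> \<rightarrow>\<^sub>M ?R"
        unfolding measurable_cong_sets[OF sets refl] prod_borel_def
        using i by (rule measurable_component_singleton)
      show "prob_space \<sigma>" using that by (simp add: space_prob_algebra)
    qed
    have \<rho>': "\<rho> k \<in> space (prob_algebra (prod_borel X {1..n}))" "distr (\<rho> k) ?R (\<lambda>x. x i) = \<mu> i" for k
      using \<rho>[of k] i by (auto simp: couplings_def)
    show ?thesis
    proof (rule measure_eqI_continuous_integrals)
      show "finite_measure (distr \<pi> ?R (\<lambda>x. x i))"
        using meas[OF \<pi>] by (intro prob_space.finite_measure prob_space.prob_space_distr)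
      \<comment> \<open>Finiteness of \<open>\<mu> i\<close> and its sigma-algebra are read off from
        its being a marginal of \<open>\<rho> 0\<close>.\<close>
      show "finite_measure (\<mu> i)"
        unfolding \<rho>'(2)[of 0, symmetric]
        using meas[OF \<rho>'(1)] by (intro prob_space.finite_measure prob_space.prob_space_distr)
      show "sets (\<mu> i) = sets ?R" unfolding \<rho>'(2)[of 0, symmetric] by simp
      fix f :: "'a \<Rightarrow> real" assume f: "continuous_on UNIV f" "bounded (range f)"
      have fR: "f \<in> borel_measurable ?R"
        using f by (intro measurable_restrict_space1 borel_measurable_continuous_onI)
      have int: "(\<integral>x. f x \<partial>distr \<sigma> ?R (\<lambda>x. x i)) = (\<integral>x. f (x i) \<partial>\<sigma>)"
        if "\<sigma> \<in> space (prob_algebra (prod_borel X {1..n}))" for \<sigma>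
        by (rule integral_distr[OF meas(1)[OF that] fR])
      have "continuous_on (PiE {1..n} X) (\<lambda>x. f (x i))"
        by (rule continuous_on_compose2[OF f(1) continuous_on_coordinate]) simp
      then have "(\<lambda>k. \<integral>x. f (x i) \<partial>\<rho> k) \<longlonglongrightarrow> (\<integral>x. f (x i) \<partial>\<pi>)"
        by (rule weak_conv_onD[OF conv _ K])
      moreover have "(\<integral>x. f (x i) \<partial>\<rho> k) = integral\<^sup>L (\<mu> i) f" for k
        using int[OF \<rho>'(1)] \<rho>'(2) by simp
      ultimately have "(\<integral>x. f (x i) \<partial>\<pi>) = integral\<^sup>L (\<mu> i) f"
        by (simp add: LIMSEQ_const_iff)
      then show "integral\<^sup>L (distr \<pi> ?R (\<lambda>x. x i)) f = integral\<^sup>L (\<mu> i) f"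
        by (simp add: int[OF \<pi>])
    qed simp
  qed
  with \<pi> show ?thesis by (simp add: couplings_def)
qed

text \<open>The integrands in \<open>martingale_couplings_iff\<close> are continuous on the compact
  product, so each test identity passes to the limit.\<close>

lemma martingale_couplings_weakly_closed:
  fixes X :: "nat \<Rightarrow> 'a::euclidean_space set"
  assumes X: "\<And>i. i \<in> {1..n} \<Longrightarrow> compact (X i)"
    and \<rho>: "\<And>k. \<rho> k \<in> martingale_couplings n X \<mu>"
    and \<pi>: "\<pi> \<in> space (prob_algebra (prod_borel X {1..n}))"
    and conv: "weak_conv_on (PiE {1..n} X) \<rho> \<pi>"
  shows "\<pi> \<in> martingale_couplings n X \<mu>"
proof -
  have K: "compact (PiE {1..n} X)" using X by (rule compact_PiE)
  have \<rho>': "\<rho> k \<in> couplings n X \<mu>" for k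
    using \<rho>[of k] by (simp add: martingale_couplings_def)
  have \<pi>': "\<pi> \<in> couplings n X \<mu>"
    by (rule couplings_weakly_closed[OF X \<rho>' \<pi> conv])
  show ?thesis
  proof (subst martingale_couplings_iff[OF X \<pi>'], assumption, intro ballI allI impI)
    fix i and b :: 'a and f :: "(nat \<Rightarrow> 'a) \<Rightarrow> real"
    assume *: "i \<in> {1..<n}" "b \<in> Basis" "continuous_on UNIV f" "bounded (range f)"
    have lim: "(\<lambda>k. \<integral>z. f (restrict z {1..i}) * (z j \<bullet> b) \<partial>\<rho> k)
        \<longlonglongrightarrow> (\<integral>z. f (restrict z {1..i}) * (z j \<bullet> b) \<partial>\<pi>)" for j
    proof (rule weak_conv_onD[OF conv _ K])
      \<comment> \<open>Each coordinate of the restriction is either a projection or the constant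
        \<open>undefined\<close>.\<close>
      have "continuous_on (PiE {1..n} X) (\<lambda>z. restrict z {1..i})"
        unfolding restrict_def
      proof (rule continuous_on_coordinatewise_then_product)
        show "continuous_on (PiE {1..n} X) (\<lambda>z. if j \<in> {1..i} then z j else undefined)" for j
          by (cases "j \<in> {1..i}") (simp_all only: if_True if_False continuous_on_coordinate continuous_on_const)
      qed
      then have "continuous_on (PiE {1..n} X) (\<lambda>z. f (restrict z {1..i}))"
        by (rule continuous_on_compose2[OF *(3)]) simp
      then show "continuous_on (PiE {1..n} X) (\<lambda>z. f (restrict z {1..i}) * (z j \<bullet> b))"
        by (intro continuous_on_mult continuous_on_inner continuous_on_coordinate continuous_on_const)
    qed
    have "(\<integral>z. f (restrict z {1..i}) * (z (i+1) \<bullet> b) \<partial>\<rho> k) = (\<integral>z. f (restrict z {1..i}) * (z i \<bullet> b) \<partial>\<rho> k)" for k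
      by (rule martingale_couplings_iff[where \<mu>=\<mu>, THEN iffD1, rule_format, OF X \<rho>' \<rho> *])
    with lim[of i] lim[of "i+1"] show "(\<integral>z. f (restrict z {1..i}) * (z (i+1) \<bullet> b) \<partial>\<pi>)
        = (\<integral>z. f (restrict z {1..i}) * (z i \<bullet> b) \<partial>\<pi>)"
      by (simp add: LIMSEQ_unique)
  qed
qed

section \<open>Passage to the limit in the perturbed minimisation problems\<close>

theorem proposition2p7:
  fixes n :: nat
    and X :: "nat \<Rightarrow> 'a::euclidean_space set"
    and \<mu> :: "nat \<Rightarrow> 'a measure"
    and c p :: "(nat \<Rightarrow> 'a) \<Rightarrow> real"
    and \<epsilon> :: "nat \<Rightarrow> real"
    and \<pi> :: "nat \<Rightarrow> (nat \<Rightarrow> 'a) measure"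
    and \<pi>\<^sub>0 :: "(nat \<Rightarrow> 'a) measure"
    and r :: "nat \<Rightarrow> nat"
  assumes "n \<ge> 1"
    and "\<And>i. i \<in> {1..n} \<Longrightarrow> compact (X i)"
    and "\<And>i. i \<in> {1..n} \<Longrightarrow> \<mu> i \<in> space (prob_algebra (restrict_space borel (X i)))"
    and "\<And>i. i \<in> {1..<n} \<Longrightarrow> convex_order (\<mu> i) (\<mu> (i+1))"
    and "continuous_on (PiE {1..n} X) c"
    and "continuous_on (PiE {1..n} X) p"
    and "\<And>k. \<epsilon> k > 0"
    and "\<epsilon> \<longlonglongrightarrow> 0"
    and "\<And>k. \<pi> k \<in> optimal_martingale_couplings n X \<mu> c p (\<epsilon> k)"
    and "strict_mono r"
    and "\<pi>\<^sub>0 \<in> space (prob_algebra (prod_borel X {1..n}))"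
    and "weak_conv_on (PiE {1..n} X) (\<pi> \<circ> r) \<pi>\<^sub>0"
  shows "\<pi>\<^sub>0 \<in> optimal_martingale_couplings n X \<mu> c p 0
    \<and> (\<integral>x. p x \<partial>\<pi>\<^sub>0) = (INF \<rho> \<in> optimal_martingale_couplings n X \<mu> c p 0. \<integral>x. p x \<partial>\<rho>)"
proof -
  note X = assms(2) and c = assms(5) and p = assms(6)
  let ?M = "martingale_couplings n X \<mu>"
  have K: "compact (PiE {1..n} X)" using X by (rule compact_PiE)
  have int: "integrable \<rho> c" "integrable \<rho> p" if "\<rho> \<in> ?M" for \<rho>
  proof -
    have \<rho>: "\<rho> \<in> space (prob_algebra (prod_borel X {1..n}))"
      using that by (simp add: martingale_couplings_def couplings_def)
    show "integrable \<rho> c" by (rule integrable_continuous_on_compact_PiE[OF X c \<rho>])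
    show "integrable \<rho> p" by (rule integrable_continuous_on_compact_PiE[OF X p \<rho>])
  qed
  have cost: "(\<integral>x. c x + e * p x \<partial>\<rho>) = integral\<^sup>L \<rho> c + e * integral\<^sup>L \<rho> p" if "\<rho> \<in> ?M" for \<rho> e
    using int[OF that] by simp
  have opt: "\<pi> k \<in> ?M"
    "\<rho> \<in> ?M \<Longrightarrow> integral\<^sup>L (\<pi> k) c + \<epsilon> k * integral\<^sup>L (\<pi> k) p \<le> integral\<^sup>L \<rho> c + \<epsilon> k * integral\<^sup>L \<rho> p"
    for k \<rho>
  proof -
    have arg: "is_arg_min (\<lambda>\<rho>. \<integral>x. c x + \<epsilon> k * p x \<partial>\<rho>) (\<lambda>\<rho>. \<rho> \<in> ?M) (\<pi> k)"
      using assms(9)[of k] by (simp add: optimal_martingale_couplings_def)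
    then show M: "\<pi> k \<in> ?M" by (simp add: is_arg_min_def)
    show "integral\<^sup>L (\<pi> k) c + \<epsilon> k * integral\<^sup>L (\<pi> k) p \<le> integral\<^sup>L \<rho> c + \<epsilon> k * integral\<^sup>L \<rho> p" if "\<rho> \<in> ?M"
      using arg that M by (auto simp: is_arg_min_linorder cost)
  qed
  have zero: "\<rho> \<in> optimal_martingale_couplings n X \<mu> c p 0 \<longleftrightarrow>
      \<rho> \<in> ?M \<and> (\<forall>\<sigma>\<in>?M. integral\<^sup>L \<rho> c \<le> integral\<^sup>L \<sigma> c)" for \<rho>
    by (auto simp: optimal_martingale_couplings_def is_arg_min_linorder)
  have \<epsilon>r: "(\<lambda>k. \<epsilon> (r k)) \<longlonglongrightarrow> 0"
    using LIMSEQ_subseq_LIMSEQ[OF assms(8,10)] by (simp add: comp_def)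
  have lim: "(\<lambda>k. integral\<^sup>L (\<pi> (r k)) c) \<longlonglongrightarrow> integral\<^sup>L \<pi>\<^sub>0 c"
    "(\<lambda>k. integral\<^sup>L (\<pi> (r k)) p) \<longlonglongrightarrow> integral\<^sup>L \<pi>\<^sub>0 p"
    using weak_conv_onD[OF assms(12) c K] weak_conv_onD[OF assms(12) p K] by simp_all
  have \<pi>0_M: "\<pi>\<^sub>0 \<in> ?M"
    by (rule martingale_couplings_weakly_closed[OF X _ assms(11,12)]) (auto simp: opt)
  have \<pi>0_opt: "\<pi>\<^sub>0 \<in> optimal_martingale_couplings n X \<mu> c p 0"
    unfolding zero
  proof (intro conjI ballI \<pi>0_M)
    fix \<sigma> assume \<sigma>: "\<sigma> \<in> ?M"
    \<comment> \<open>The integrals of \<open>p\<close> converge along the subsequence, so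
      multiplying them by \<open>\<epsilon> (r k)\<close> makes the perturbation vanish.\<close>
    have "(\<lambda>k. integral\<^sup>L (\<pi> (r k)) c + \<epsilon> (r k) * integral\<^sup>L (\<pi> (r k)) p) \<longlonglongrightarrow> integral\<^sup>L \<pi>\<^sub>0 c + 0 * integral\<^sup>L \<pi>\<^sub>0 p"
      by (intro tendsto_intros lim \<epsilon>r)
    moreover have "(\<lambda>k. integral\<^sup>L \<sigma> c + \<epsilon> (r k) * integral\<^sup>L \<sigma> p) \<longlonglongrightarrow> integral\<^sup>L \<sigma> c + 0 * integral\<^sup>L \<sigma> p"
      by (intro tendsto_intros \<epsilon>r)
    ultimately have "integral\<^sup>L \<pi>\<^sub>0 c + 0 * integral\<^sup>L \<pi>\<^sub>0 p \<le> integral\<^sup>L \<sigma> c + 0 * integral\<^sup>L \<sigma> p"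
      by (rule LIMSEQ_le) (use opt(2)[OF \<sigma>] in blast)
    then show "integral\<^sup>L \<pi>\<^sub>0 c \<le> integral\<^sup>L \<sigma> c" by simp
  qed
  have least: "integral\<^sup>L \<pi>\<^sub>0 p \<le> integral\<^sup>L \<sigma> p" if "\<sigma> \<in> optimal_martingale_couplings n X \<mu> c p 0" for \<sigma>
  proof (rule LIMSEQ_le_const2[OF lim(2)], intro exI allI impI)
    fix k
    \<comment> \<open>Each \<open>\<pi> (r k)\<close> competes in the unperturbed problem, which
      \<open>\<sigma>\<close> solves. Combined with the optimality of \<open>\<pi> (r k)\<close>
      this cancels the \<open>c\<close> terms, and the positive factor
      \<open>\<epsilon> (r k)\<close> can be divided out.\<close>
    from that have \<sigma>: "\<sigma> \<in> ?M" "integral\<^sup>L \<sigma> c \<le> integral\<^sup>L (\<pi> (r k)) c"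
      using opt(1) by (auto simp: zero)
    with opt(2)[OF \<sigma>(1), of "r k"] have "\<epsilon> (r k) * integral\<^sup>L (\<pi> (r k)) p \<le> \<epsilon> (r k) * integral\<^sup>L \<sigma> p"
      by linarith
    with assms(7)[of "r k"] show "integral\<^sup>L (\<pi> (r k)) p \<le> integral\<^sup>L \<sigma> p" by simp
  qed
  have "(INF \<rho> \<in> optimal_martingale_couplings n X \<mu> c p 0. \<integral>x. p x \<partial>\<rho>) = integral\<^sup>L \<pi>\<^sub>0 p"
    using \<pi>0_opt least by (intro cInf_eq_minimum) auto
  with \<pi>0_opt show ?thesis by simp
qed

end
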